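(* Let $\ell\in2\mathbb N_0$, let $\bar D,\bar E$ be the differential operators and $\Psi$ the matrix valued polynomial function given in the context, and let $\widetilde D=\Psi^{-1}\bar D\,\Psi$ and $\widetilde E=\Psi^{-1}\bar E\,\Psi$ (i.e. $\widetilde DF=\Psi^{-1}\bar D(\Psi F)$, $\widetilde EF=\Psi^{-1}\bar E(\Psi F)$). Then $$\widetilde DF=(1-u^2)F''+(-uC+S_1)F'+\Lambda_0F,\qquad \widetilde EF=(uR_2+R_1)F'+M_0F,$$ for any $C^\infty$-function $F$ on $(0,1)$ with values in $\mathbb C^{\ell+1}$, where $$C=\sum_{j=0}^\ell(2j+3)E_{jj},\qquad S_1=\sum_{j=0}^{\ell-1}2(j+1)E_{j,j+1},$$ $$R_1=\sum_{j=0}^{\ell-1}\tfrac{j+1}{2}E_{j,j+1}-\sum_{j=0}^{\ell-1}\tfrac{\ell-j}{2}E_{j+1,j},\qquad R_2=\sum_{j=0}^\ell(\tfrac\ell2-j)E_{jj},$$ $$\Lambda_0=\sum_{j=0}^\ell-j(j+2)E_{jj},\qquad M_0=\sum_{j=0}^\ell-j(\tfrac\ell2+1)E_{jj}.$$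
   Context: $E_{jk}$, $0\le j,k\le\ell$, are the matrix units of size $\ell+1$. For $\mathbb C^{\ell+1}$-valued functions $P$ of $u\in(0,1)$: $$\bar DP=(1-u^2)P''-uCP'-VP,\qquad \bar EP=\tfrac i2\big((1-u^2)Q_0+Q_1\big)P'-\tfrac i2uMP-\tfrac12V_0P,$$ with $C=\sum_{j=0}^\ell(2j+3)E_{jj}$, $V=\sum_{j=0}^\ell j(j+2)E_{jj}$, $Q_0=\sum_{j=0}^{\ell-1}\frac{(j+1)(\ell+j+2)}{2j+3}E_{j,j+1}$, $Q_1=\sum_{j=1}^\ell\frac{j(\ell-j+1)}{2j-1}E_{j,j-1}$, $M=\sum_{j=0}^{\ell-1}(j+1)(\ell+j+2)E_{j,j+1}$, $V_0=\sum_{j=0}^\ell j(j+1)E_{jj}$. $\Psi(u)=(\Psi_{jk}(u))_{0\le j,k\le\ell}$ is the upper triangular matrix polynomial with $$\Psi_{jk}(u)=\frac{(2j+1)(-2i)^j\,k!\,j!}{(k+j+1)!}\,C^{j+1}_{k-j}(u)\quad(0\le j\le k\le\ell),\qquad \Psi_{jk}=0\ (j>k),$$ where $C_{k-j}^{j+1}(u)=\binom{k+j+1}{k-j}\,{}_2F_1\!\left(-k+j,k+j+2;j+\tfrac32;\tfrac{1-u}2\right)$ is the Gegenbauer polynomial. Its diagonal entries are nonzero constants, so $\Psi(u)$ is invertible for all $u$. *)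

theory Defs
  imports "HOL-Analysis.Derivative" "Jordan_Normal_Form.Gauss_Jordan_Elimination"
begin

text \<open>
  Vectors and matrices of size \<open>l + 1\<close> are those of \<open>Jordan_Normal_Form\<close>, indexed from \<open>0\<close> to \<open>l\<close>
  as in the source. A matrix given by a sum of matrix units is written through its entries:
  the coefficient of the unit \<open>E\<^sub>j\<^sub>k\<close> is the entry in row \<open>j\<close>, column \<open>k\<close>.
  Natural numbers are cast before subtracting or dividing. The exceptions are in \<open>gegenbauer\<close>
  and \<open>Psi\<close>, where the subtrahend never exceeds the minuend in the values used.
\<close>

subsection \<open>Calculus for vector valued functions\<close>

definition vderiv :: "(real \<Rightarrow> complex Matrix.vec) \<Rightarrow> real \<Rightarrow> complex Matrix.vec" where
  "vderiv P u = Matrix.vec (dim_vec (P u)) (\<lambda>i. vector_derivative (\<lambda>t. vec_index (P t) i) (at u))"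

text \<open>Meant for open \<open>S\<close>; the values of \<open>f\<close> outside \<open>S\<close> are then irrelevant.\<close>

definition smooth_fun_on :: "real set \<Rightarrow> (real \<Rightarrow> complex) \<Rightarrow> bool" where
  "smooth_fun_on S f \<longleftrightarrow>
     (\<forall>n. \<forall>u\<in>S. ((\<lambda>g t. vector_derivative g (at t)) ^^ n) f differentiable (at u))"

definition smooth_vec_on :: "nat \<Rightarrow> real set \<Rightarrow> (real \<Rightarrow> complex Matrix.vec) \<Rightarrow> bool" where
  "smooth_vec_on n S F \<longleftrightarrow>
     (\<forall>u\<in>S. F u \<in> carrier_vec n) \<and> (\<forall>i<n. smooth_fun_on S (\<lambda>u. vec_index (F u) i))"

subsection \<open>The differential operators \<open>D_bar\<close> and \<open>E_bar\<close>\<close>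

definition C_mat :: "nat \<Rightarrow> complex mat" where
  "C_mat l = mat (l + 1) (l + 1) (\<lambda>(j, k). if k = j then 2 * of_nat j + 3 else 0)"

definition V_mat :: "nat \<Rightarrow> complex mat" where
  "V_mat l = mat (l + 1) (l + 1) (\<lambda>(j, k). if k = j then of_nat j * (of_nat j + 2) else 0)"

definition Q0_mat :: "nat \<Rightarrow> complex mat" where
  "Q0_mat l = mat (l + 1) (l + 1) (\<lambda>(j, k).
     if k = j + 1 then (of_nat j + 1) * (of_nat l + of_nat j + 2) / (2 * of_nat j + 3) else 0)"

definition Q1_mat :: "nat \<Rightarrow> complex mat" where
  "Q1_mat l = mat (l + 1) (l + 1) (\<lambda>(j, k).
     if j = k + 1 then of_nat j * (of_nat l - of_nat j + 1) / (2 * of_nat j - 1) else 0)"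

definition M_mat :: "nat \<Rightarrow> complex mat" where
  "M_mat l = mat (l + 1) (l + 1) (\<lambda>(j, k).
     if k = j + 1 then (of_nat j + 1) * (of_nat l + of_nat j + 2) else 0)"

definition V0_mat :: "nat \<Rightarrow> complex mat" where
  "V0_mat l = mat (l + 1) (l + 1) (\<lambda>(j, k). if k = j then of_nat j * (of_nat j + 1) else 0)"

definition D_bar :: "nat \<Rightarrow> (real \<Rightarrow> complex Matrix.vec) \<Rightarrow> real \<Rightarrow> complex Matrix.vec" where
  "D_bar l P u =
     of_real (1 - u\<^sup>2) \<cdot>\<^sub>v vderiv (vderiv P) u
     - of_real u \<cdot>\<^sub>v (C_mat l *\<^sub>v vderiv P u)
     - V_mat l *\<^sub>v P u"

definition E_bar :: "nat \<Rightarrow> (real \<Rightarrow> complex Matrix.vec) \<Rightarrow> real \<Rightarrow> complex Matrix.vec" where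
  "E_bar l P u =
     (\<i> / 2) \<cdot>\<^sub>v ((of_real (1 - u\<^sup>2) \<cdot>\<^sub>m Q0_mat l + Q1_mat l) *\<^sub>v vderiv P u)
     - (\<i> / 2 * of_real u) \<cdot>\<^sub>v (M_mat l *\<^sub>v P u)
     - (1 / 2) \<cdot>\<^sub>v (V0_mat l *\<^sub>v P u)"

subsection \<open>The matrix polynomial \<open>Psi\<close>\<close>

definition hyp2F1 :: "real \<Rightarrow> real \<Rightarrow> real \<Rightarrow> real \<Rightarrow> real" where
  "hyp2F1 a b c z = (\<Sum>n. pochhammer a n * pochhammer b n / (pochhammer c n * fact n) * z ^ n)"

text \<open>
  The Gegenbauer polynomial of degree \<open>n\<close> with integer parameter \<open>m \<ge> 1\<close>, in its hypergeometric
  form. For \<open>m = j + 1\<close> and \<open>n = k - j\<close> it reads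
  \<open>(k + j + 1 choose k - j) * hyp2F1 (- k + j) (k + j + 2) (j + 3/2) ((1 - u) / 2)\<close>.
\<close>

definition gegenbauer :: "nat \<Rightarrow> nat \<Rightarrow> real \<Rightarrow> real" where
  "gegenbauer m n u = real ((n + 2 * m - 1) choose n) *
     hyp2F1 (- real n) (real n + 2 * real m) (real m + 1 / 2) ((1 - u) / 2)"

definition Psi :: "nat \<Rightarrow> real \<Rightarrow> complex mat" where
  "Psi l u = mat (l + 1) (l + 1) (\<lambda>(j, k).
     if j \<le> k
     then (2 * of_nat j + 1) * (- 2 * \<i>) ^ j * fact k * fact j / fact (k + j + 1)
            * of_real (gegenbauer (j + 1) (k - j) u)
     else 0)"

subsection \<open>The conjugated operators\<close>

definition conj_Psi ::
  "nat \<Rightarrow> ((real \<Rightarrow> complex Matrix.vec) \<Rightarrow> real \<Rightarrow> complex Matrix.vec) \<Rightarrow>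
   (real \<Rightarrow> complex Matrix.vec) \<Rightarrow> real \<Rightarrow> complex Matrix.vec" where
  "conj_Psi l T F u = the (mat_inverse (Psi l u)) *\<^sub>v T (\<lambda>t. Psi l t *\<^sub>v F t) u"

definition D_tilde :: "nat \<Rightarrow> (real \<Rightarrow> complex Matrix.vec) \<Rightarrow> real \<Rightarrow> complex Matrix.vec" where
  "D_tilde l = conj_Psi l (D_bar l)"

definition E_tilde :: "nat \<Rightarrow> (real \<Rightarrow> complex Matrix.vec) \<Rightarrow> real \<Rightarrow> complex Matrix.vec" where
  "E_tilde l = conj_Psi l (E_bar l)"

subsection \<open>The coefficients of the conjugated operators\<close>

definition S1_mat :: "nat \<Rightarrow> complex mat" where
  "S1_mat l = mat (l + 1) (l + 1) (\<lambda>(j, k). if k = j + 1 then 2 * (of_nat j + 1) else 0)"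

text \<open>
  Below the diagonal, row \<open>j\<close> and column \<open>k\<close> with \<open>j = k + 1\<close> carry the coefficient of the unit
  with indices \<open>(k + 1, k)\<close>, hence the factor \<open>l - k\<close>.
\<close>

definition R1_mat :: "nat \<Rightarrow> complex mat" where
  "R1_mat l = mat (l + 1) (l + 1) (\<lambda>(j, k).
     if k = j + 1 then (of_nat j + 1) / 2
     else if j = k + 1 then - ((of_nat l - of_nat k) / 2)
     else 0)"

definition R2_mat :: "nat \<Rightarrow> complex mat" where
  "R2_mat l = mat (l + 1) (l + 1) (\<lambda>(j, k). if k = j then of_nat l / 2 - of_nat j else 0)"

definition Lambda0_mat :: "nat \<Rightarrow> complex mat" where
  "Lambda0_mat l = mat (l + 1) (l + 1) (\<lambda>(j, k).
     if k = j then - of_nat j * (of_nat j + 2) else 0)"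

definition M0_mat :: "nat \<Rightarrow> complex mat" where
  "M0_mat l = mat (l + 1) (l + 1) (\<lambda>(j, k).
     if k = j then - of_nat j * (of_nat l / 2 + 1) else 0)"

end

theory Submission
  imports Defs "HOL-Computational_Algebra.Polynomial" "Jordan_Normal_Form.Determinant"
begin

text \<open>
  Since \<open>C\<^sup>j\<^sup>+\<^sup>1\<close> of degree \<open>k - j\<close> is \<open>1 / (2\<^sup>j j!)\<close> times the \<open>j\<close>-th derivative of the Chebyshev
  polynomial \<open>U\<^sub>k\<close> of the second kind, the entry of \<open>\<Psi>\<close> in row \<open>j\<close> and column \<open>k\<close> is
  \<open>(2 j + 1) (- i)\<^sup>j \<phi>\<^sub>j\<^sub>k\<close> with \<open>\<phi>\<^sub>j\<^sub>k = k! / (k + j + 1)! U\<^sub>k\<^sup>(\<^sup>j\<^sup>)\<close>: each column consists of the successive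
  derivatives of one function (\<open>Psi_eq_phi\<close>). Differentiating in \<open>u\<close> is therefore a shift in \<open>j\<close>, and every
  identity between entries is a contiguity relation between the derivatives of \<open>U\<^sub>k\<^sub>-\<^sub>1\<close>, \<open>U\<^sub>k\<close>
  and \<open>U\<^sub>k\<^sub>+\<^sub>1\<close>. All of these follow from the two relations in \<open>dU_lower_raise\<close>.

  Putting \<open>\<Psi> F\<close> into the operators and applying the product rule, the claim separates by the order of
  the derivative of \<open>F\<close>. With the leading coefficient \<open>A = (i/2) ((1 - u\<^sup>2) Q\<^sub>0 + Q\<^sub>1)\<close> of the first order
  operator, it amounts to
    \<^item> \<open>(1 - u\<^sup>2) \<Psi>'' - u C \<Psi>' - V \<Psi> = \<Psi> \<Lambda>\<^sub>0\<close>, the Gegenbauer differential equation in each entry;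
    \<^item> \<open>2 (1 - u\<^sup>2) \<Psi>' - u C \<Psi> = \<Psi> (- u C + S\<^sub>1)\<close>, where \<open>S\<^sub>1\<close> pairs column \<open>k\<close> with column \<open>k - 1\<close>: the
      formula for \<open>(1 - u\<^sup>2) \<phi>'\<^sub>j\<^sub>k\<close> by \<open>\<phi>\<^sub>j\<^sub>k\<close> and \<open>\<phi>\<close> at \<open>k - 1\<close>;
    \<^item> \<open>A \<Psi> = \<Psi> (u R\<^sub>2 + R\<^sub>1)\<close>, where moving up and down in the row index is turned into moving left and
      right in the column index;
    \<^item> \<open>A \<Psi>' - (i/2) u M \<Psi> - (1/2) V\<^sub>0 \<Psi> = \<Psi> M\<^sub>0\<close>, again the differential equation, now with shifted \<open>j\<close>.

  These are the four lemmas named \<open>intertwining\<close>. They say that both operators applied to \<open>\<Psi> F\<close>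
  equal \<open>\<Psi>\<close> applied to the asserted right-hand sides, and \<open>\<Psi>\<close> is triangular with nonzero diagonal, so it cancels.
\<close>

section \<open>Derivatives of Chebyshev polynomials\<close>

fun cheb_U :: "nat \<Rightarrow> real poly" where
  "cheb_U 0 = 1"
| "cheb_U (Suc 0) = [:0, 2:]"
| "cheb_U (Suc (Suc k)) = [:0, 2:] * cheb_U (Suc k) - cheb_U k"

definition dU :: "nat \<Rightarrow> nat \<Rightarrow> real poly" where
  "dU j k = (pderiv ^^ j) (cheb_U k)"

lemma dU_0: "dU 0 k = cheb_U k"
  by (simp add: dU_def)

lemma pderiv_dU: "pderiv (dU j k) = dU (Suc j) k"
  by (simp add: dU_def)

lemma dU_three_term_0: "dU 0 (Suc (Suc k)) = 2 * ([:0, 1:] * dU 0 (Suc k)) - dU 0 k"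
  by (simp add: dU_0 numeral_poly)

text \<open>
  The formulas \<open>U'\<^sub>k = u U'\<^sub>k\<^sub>+\<^sub>1 - (k + 1) U\<^sub>k\<^sub>+\<^sub>1\<close> and \<open>U'\<^sub>k\<^sub>+\<^sub>1 = u U'\<^sub>k + (k + 2) U\<^sub>k\<close> support each other
  in one induction: differentiating the recurrence and using the first for \<open>k\<close> gives the second for
  \<open>k + 1\<close>, which together with both for \<open>k\<close> gives the first for \<open>k + 1\<close>.
\<close>

lemma dU_lower_raise_0:
  "dU 1 k = [:0, 1:] * dU 1 (Suc k) - of_nat (k + 1) * dU 0 (Suc k) \<and>
   dU 1 (Suc k) = [:0, 1:] * dU 1 k + of_nat (k + 2) * dU 0 k"
proof (induction k)
  case 0
  have "pderiv [:0, 2 :: real:] = 2" by (simp add: pderiv_pCons numeral_poly)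
  then show ?case by (simp add: dU_def numeral_poly)
next
  case (Suc k)
  let ?X = "[:0, 1:] :: real poly"
  have dX: "pderiv ?X = 1" by (simp add: pderiv_pCons one_pCons)
  have "dU 1 (Suc (Suc k)) = pderiv (dU 0 (Suc (Suc k)))"
    by (simp add: pderiv_dU)
  also have "\<dots> = pderiv (?X * dU 0 (Suc k) + ?X * dU 0 (Suc k) - dU 0 k)"
    by (simp only: dU_three_term_0 mult_2)
  also have "\<dots> = 2 * (?X * dU 1 (Suc k) + dU 0 (Suc k)) - dU 1 k"
    by (simp only: pderiv_diff pderiv_add pderiv_mult dX pderiv_dU mult_2 One_nat_def[symmetric])
  finally have d: "dU 1 (Suc (Suc k)) = 2 * (?X * dU 1 (Suc k) + dU 0 (Suc k)) - dU 1 k" .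
  from Suc.IH have a: "dU 1 k = ?X * dU 1 (Suc k) - of_nat (k + 1) * dU 0 (Suc k)"
    and c: "dU 1 (Suc k) = ?X * dU 1 k + of_nat (k + 2) * dU 0 k" by blast+
  have c': "dU 1 (Suc (Suc k)) = ?X * dU 1 (Suc k) + of_nat (Suc k + 2) * dU 0 (Suc k)"
    unfolding d a by (simp add: algebra_simps del: mult_pCons_left mult_pCons_right)
  have "?X * dU 1 (Suc (Suc k)) - of_nat (Suc k + 1) * dU 0 (Suc (Suc k))
     = ?X * (?X * dU 1 (Suc k) - of_nat (k + 1) * dU 0 (Suc k)) + of_nat (k + 2) * dU 0 k"
    unfolding c' dU_three_term_0[of k]
    by (simp add: algebra_simps del: mult_pCons_left mult_pCons_right)
  also have "\<dots> = dU 1 (Suc k)"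
    using a c by simp
  finally show ?case using c' by simp
qed

text \<open>
  Differentiating either relation only moves the scalar coefficient, as \<open>u\<close> is the only factor
  that is not constant.
\<close>

lemma dU_lower_raise:
  "dU (Suc j) k = [:0, 1:] * dU (Suc j) (Suc k) - (of_nat k + 1 - of_nat j) * dU j (Suc k) \<and>
   dU (Suc j) (Suc k) = [:0, 1:] * dU (Suc j) k + (of_nat k + 2 + of_nat j) * dU j k"
proof (induction j)
  case 0
  show ?case using dU_lower_raise_0[of k] by (simp add: algebra_simps)
next
  case (Suc j)
  let ?X = "[:0, 1:] :: real poly"
  have dX: "pderiv ?X = 1" by (simp add: pderiv_pCons one_pCons)
  have dc: "pderiv (of_nat k + 1 - of_nat j) = (0 :: real poly)"
     "pderiv (of_nat k + 2 + of_nat j) = (0 :: real poly)"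
    by (simp_all add: of_nat_poly pderiv_diff pderiv_add numeral_poly)
  from Suc.IH have "pderiv (dU (Suc j) k)
      = pderiv (?X * dU (Suc j) (Suc k) - (of_nat k + 1 - of_nat j) * dU j (Suc k))"
    and "pderiv (dU (Suc j) (Suc k))
      = pderiv (?X * dU (Suc j) k + (of_nat k + 2 + of_nat j) * dU j k)" by metis+
  then show ?case
    by (simp only: pderiv_diff pderiv_add pderiv_mult dX dc pderiv_dU)
       (simp add: algebra_simps del: mult_pCons_left mult_pCons_right)
qed

text \<open>The values of these polynomials; the relations between them are used pointwise from here on.\<close>

definition W :: "nat \<Rightarrow> nat \<Rightarrow> real \<Rightarrow> real" where
  "W j k u = poly (dU j k) u"

lemma W_lower: "W (Suc j) k u = u * W (Suc j) (Suc k) u - (real k + 1 - real j) * W j (Suc k) u"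
  using arg_cong[OF conjunct1[OF dU_lower_raise[of j k]], of "\<lambda>p. poly p u"]
  by (simp add: W_def of_nat_poly)

lemma W_raise: "W (Suc j) (Suc k) u = u * W (Suc j) k u + (real k + 2 + real j) * W j k u"
  using arg_cong[OF conjunct2[OF dU_lower_raise[of j k]], of "\<lambda>p. poly p u"]
  by (simp add: W_def of_nat_poly numeral_poly)

lemma W_deriv_up:
  "(1 - u\<^sup>2) * W (Suc j) k u = (real k + 2 + real j) * u * W j k u - (real k + 1 - real j) * W j (Suc k) u"
proof -
  have "W (Suc j) k u
      = u * (u * W (Suc j) k u + (real k + 2 + real j) * W j k u) - (real k + 1 - real j) * W j (Suc k) u"
    using W_lower[of j k u] W_raise[of j k u] by simp
  then show ?thesis by (simp add: algebra_simps power2_eq_square)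
qed

text \<open>The Gegenbauer differential equation, as the lowering relation followed by the raising one.\<close>

lemma W_ode:
  "(1 - u\<^sup>2) * W (Suc (Suc j)) k u
    = (2 * real j + 3) * u * W (Suc j) k u - (real k - real j) * (real k + real j + 2) * W j k u"
  using W_deriv_up[of u "Suc j" k] W_raise[of j k u]
  by (simp add: algebra_simps power2_eq_square) algebra

section \<open>Expansion at the point one and the Gegenbauer polynomials\<close>

declare binomial_Suc_Suc [simp del]

lemma binomial_second_difference:
  "real ((k + m + 4) choose (2 * m + 3)) - 2 * real ((k + m + 3) choose (2 * m + 3))
     + real ((k + m + 2) choose (2 * m + 3)) = real ((k + m + 2) choose (2 * m + 1))"
proof -
  have "(k + m + 4) choose (2 * m + 3) = ((k + m + 3) choose (2 * m + 2)) + ((k + m + 3) choose (2 * m + 3))"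
    "(k + m + 3) choose (2 * m + 3) = ((k + m + 2) choose (2 * m + 2)) + ((k + m + 2) choose (2 * m + 3))"
    "(k + m + 3) choose (2 * m + 2) = ((k + m + 2) choose (2 * m + 1)) + ((k + m + 2) choose (2 * m + 2))"
    by (simp_all add: eval_nat_numeral binomial_Suc_Suc)
  then show ?thesis by simp
qed

text \<open>
  With \<open>y = 2 u - 2\<close> the Chebyshev recurrence says that the second difference of \<open>U\<close> in \<open>k\<close> is
  \<open>y U\<^sub>k\<^sub>+\<^sub>1\<close>, so the coefficients of the powers of \<open>y\<close> obey the second difference rule for binomial
  coefficients. The upper limit \<open>N\<close> is left free because the recurrence combines three different
  degrees; the surplus coefficients vanish.
\<close>

lemma W_0_expansion:
  "N \<ge> k \<Longrightarrow> W 0 k u = (\<Sum>m\<le>N. real ((k + m + 1) choose (2 * m + 1)) * (2 * u - 2) ^ m)"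
proof (induction k arbitrary: N rule: cheb_U.induct)
  case 1
  have "(\<Sum>m\<le>N. real ((0 + m + 1) choose (2 * m + 1)) * (2 * u - 2) ^ m)
      = (\<Sum>m\<le>N. if m = 0 then 1 else 0)"
    by (intro sum.cong) (auto simp: binomial_eq_0)
  then show ?case by (simp add: W_def dU_0)
next
  case 2
  have "(\<Sum>m\<le>N. real ((Suc 0 + m + 1) choose (2 * m + 1)) * (2 * u - 2) ^ m)
      = (\<Sum>m\<in>{0,1}. real ((Suc 0 + m + 1) choose (2 * m + 1)) * (2 * u - 2) ^ m)"
    using 2 by (intro sum.mono_neutral_right) (auto simp: binomial_eq_0)
  then show ?case by (simp add: W_def dU_0 eval_nat_numeral)
next
  case (3 k)
  let ?b = "\<lambda>k m. real ((k + m + 1) choose (2 * m + 1))"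
  let ?y = "2 * u - 2"
  obtain N' where N': "N = Suc N'" using 3 by (cases N) auto
  have top: "?b (Suc k) N = 0" using 3 by (simp add: binomial_eq_0)
  have "W 0 (Suc (Suc k)) u = 2 * u * W 0 (Suc k) u - W 0 k u"
    by (simp add: W_def dU_0)
  also have "\<dots> = (?y + 2) * (\<Sum>m\<le>N. ?b (Suc k) m * ?y ^ m) - (\<Sum>m\<le>N. ?b k m * ?y ^ m)"
    using "3.IH"(1)[of N] "3.IH"(2)[of N] "3.prems" by simp
  also have "\<dots> = (\<Sum>m\<le>N. ?b (Suc k) m * ?y ^ Suc m) + (\<Sum>m\<le>N. (2 * ?b (Suc k) m - ?b k m) * ?y ^ m)"
    by (simp add: ring_distribs sum.distrib sum_subtractf sum_distrib_left mult_ac)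
  also have "(\<Sum>m\<le>N. ?b (Suc k) m * ?y ^ Suc m) = (\<Sum>m\<le>N'. ?b (Suc k) m * ?y ^ Suc m)"
    using top unfolding N' by simp
  also have "\<dots> + (\<Sum>m\<le>N. (2 * ?b (Suc k) m - ?b k m) * ?y ^ m)
     = (2 * ?b (Suc k) 0 - ?b k 0) + (\<Sum>m\<le>N'. (?b (Suc k) m + 2 * ?b (Suc k) (Suc m) - ?b k (Suc m)) * ?y ^ Suc m)"
    unfolding N' sum.atMost_Suc_shift
    by (simp add: ring_distribs sum.distrib sum_subtractf)
  also have "\<dots> = ?b (Suc (Suc k)) 0 + (\<Sum>m\<le>N'. ?b (Suc (Suc k)) (Suc m) * ?y ^ Suc m)"
  proof -
    have "?b (Suc k) m + 2 * ?b (Suc k) (Suc m) - ?b k (Suc m) = ?b (Suc (Suc k)) (Suc m)" for m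
      using binomial_second_difference[of k m] by (simp add: eval_nat_numeral)
    then show ?thesis by simp
  qed
  also have "\<dots> = (\<Sum>m\<le>N. ?b (Suc (Suc k)) m * ?y ^ m)"
    unfolding N' sum.atMost_Suc_shift by simp
  finally show ?case .
qed

text \<open>
  The closed form is stable under differentiation: the factor \<open>2 (m + 1)\<close> that comes out of
  \<open>y\<^sup>m\<^sup>+\<^sup>1\<close> is absorbed by \<open>2\<^sup>j (j + m + 1)! / (m + 1)!\<close>, and the binomial coefficient depends on \<open>j\<close> and \<open>m\<close>
  through \<open>j + m\<close> only.
\<close>

lemma W_expansion:
  "W j k u = (\<Sum>m\<le>k. 2 ^ j * fact (j + m) / fact m * real ((k + j + m + 1) choose (2 * (j + m) + 1))
      * (2 * u - 2) ^ m)"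
proof (induction j arbitrary: u)
  case 0
  show ?case using W_0_expansion[of k k u] by simp
next
  case (Suc j)
  define e where
    "e j m = 2 ^ j * fact (j + m) / fact m * real ((k + j + m + 1) choose (2 * (j + m) + 1))" for j m
  have e: "2 * (real m + 1) * e j (Suc m) = e (Suc j) m" for m
    by (simp add: e_def divide_simps add_ac)
  have "(W j k has_real_derivative W (Suc j) k u) (at u)"
    unfolding W_def[abs_def] pderiv_dU[symmetric] by (rule poly_DERIV)
  moreover have "(W j k has_real_derivative (\<Sum>m\<le>k. e j m * (real m * (2 * u - 2) ^ (m - 1) * 2))) (at u)"
    unfolding Suc.IH[abs_def] e_def[symmetric]
    by (auto intro!: derivative_eq_intros sum.cong)
  ultimately have "W (Suc j) k u = (\<Sum>m\<le>k. e j m * (real m * (2 * u - 2) ^ (m - 1) * 2))"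
    by (rule DERIV_unique)
  also have "\<dots> = (\<Sum>m\<le>Suc k. e j m * (real m * (2 * u - 2) ^ (m - 1) * 2))"
    by (simp add: e_def binomial_eq_0)
  also have "\<dots> = (\<Sum>m\<le>k. (2 * (real m + 1) * e j (Suc m)) * (2 * u - 2) ^ m)"
    unfolding sum.atMost_Suc_shift by (simp add: algebra_simps)
  also have "\<dots> = (\<Sum>m\<le>k. e (Suc j) m * (2 * u - 2) ^ m)"
    by (simp only: e)
  finally show ?case by (simp add: e_def)
qed

lemma W_eq_0: "k < j \<Longrightarrow> W j k u = 0"
  unfolding W_expansion by (intro sum.neutral) (auto simp: binomial_eq_0)

lemma binomial_diagonal_shift:
  "real ((d + s + 2) choose d) * (real s + 1) * (real s + 2)
     = (real d + real s + 2) * (real d + 1) * real ((d + s + 1) choose (d + 1))"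
proof -
  have "real ((d + s + 2) choose d) = fact (d + s + 2) / (fact d * fact (s + 2))"
    "real ((d + s + 1) choose (d + 1)) = fact (d + s + 1) / (fact (d + 1) * fact s)"
    by (subst binomial_fact; simp)+
  moreover have "fact (d + s + 2) = (real d + real s + 2) * fact (d + s + 1)"
    "fact (s + 2) = (real s + 1) * (real s + 2) * fact s"
    "fact (d + 1) = (real d + 1) * fact d"
    by (simp_all add: algebra_simps)
  ultimately show ?thesis
    by (simp only:) (simp add: divide_simps add_nonneg_eq_0_iff)
qed

text \<open>
  The coefficients of the hypergeometric series, rewritten so as to match those of the expansion in
  \<open>2 u - 2 = - 4 ((1 - u) / 2)\<close>. Both sides have the same ratio of consecutive terms.
\<close>

lemma gegenbauer_coeff:
  assumes "m \<le> n"
  shows "real ((n + 2 * j + 1) choose n) * (pochhammer (- real n) m * pochhammer (real n + 2 * real j + 2) m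
      / (pochhammer (real j + 3 / 2) m * fact m))
    = (- 4) ^ m * (fact (j + m) / (fact j * fact m))
      * real ((n + 2 * j + m + 1) choose (n - m))"
  using assms
proof (induction m)
  case 0
  then show ?case by simp
next
  case (Suc m)
  let ?L = "real ((n + 2 * j + 1) choose n) * (pochhammer (- real n) m * pochhammer (real n + 2 * real j + 2) m
      / (pochhammer (real j + 3 / 2) m * fact m))"
  let ?r = "(real m - real n) * (real n + 2 * real j + 2 + real m) / ((real j + 3 / 2 + real m) * (real m + 1))"
  have "real ((n + 2 * j + 1) choose n) * (pochhammer (- real n) (Suc m) * pochhammer (real n + 2 * real j + 2) (Suc m)
      / (pochhammer (real j + 3 / 2) (Suc m) * fact (Suc m))) = ?L * ?r"
    by (simp add: pochhammer_Suc add_ac mult_ac)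
  also have "?L = (- 4) ^ m * (fact (j + m) / (fact j * fact m)) * real ((n + 2 * j + m + 1) choose (n - m))"
    using Suc by simp
  also have "\<dots> * ?r = (- 4) ^ Suc m * (fact (j + Suc m) / (fact j * fact (Suc m)))
      * real ((n + 2 * j + Suc m + 1) choose (n - Suc m))"
  proof -
    obtain d where d: "n = m + Suc d" using Suc.prems by (metis less_imp_Suc_add Suc_le_eq add_Suc_right)
    let ?c = "real ((n + 2 * j + m + 1) choose (n - m))"
    let ?c' = "real ((n + 2 * j + Suc m + 1) choose (n - Suc m))"
    have "?c' * (2 * real j + 2 * real m + 2) * (2 * real j + 2 * real m + 3)
       = (real n + 2 * real j + real m + 2) * (real n - real m) * ?c"
      using binomial_diagonal_shift[of d "2 * m + 2 * j + 1"] unfolding d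
      by (simp add: algebra_simps)
    then have c: "?c' = (real n + 2 * real j + real m + 2) * (real n - real m) * ?c
       / ((2 * (real j + real m + 1)) * (2 * real j + 2 * real m + 3))"
      by (simp add: nonzero_eq_divide_eq mult.assoc add_nonneg_eq_0_iff)
    have f: "fact (j + Suc m) = (real j + real m + 1) * fact (j + m)"
      "fact (Suc m) = (real m + 1) * fact m"
      by (simp_all add: algebra_simps)
    have h: "real j + 3 / 2 + real m = (2 * real j + 2 * real m + 3) / 2"
      "real m - real n = - (real n - real m)"
      "real n + 2 * real j + 2 + real m = real n + 2 * real j + real m + 2" by simp_all
    have cancel: "q * (P / (f * g)) * B * ((- b) * a / ((y / 2) * z))
        = (- 4) * q * (x * P / (f * (z * g))) * (a * b * B / ((2 * x) * y))"
      if "f \<noteq> 0" "g \<noteq> 0" "x \<noteq> 0" "y \<noteq> 0" "z \<noteq> 0" for q P f g B a b x y z :: real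
      using that by (simp add: field_simps)
    show ?thesis
      unfolding c h f power_Suc by (rule cancel) (simp_all add: add_nonneg_eq_0_iff)
  qed
  finally show ?case .
qed

text \<open>
  The series breaks off after the term of index \<open>k - j\<close>, hence this holds for every real \<open>u\<close>,
  without a convergence condition.
\<close>

lemma W_gegenbauer:
  assumes "j \<le> k"
  shows "2 ^ j * fact j * gegenbauer (j + 1) (k - j) u = W j k u"
proof -
  define n where "n = k - j"
  have k: "k = n + j" using assms by (simp add: n_def)
  let ?h = "\<lambda>m. pochhammer (- real n) m * pochhammer (real n + 2 * real (j + 1)) m
      / (pochhammer (real (j + 1) + 1 / 2) m * fact m) * ((1 - u) / 2) ^ m"
  have "hyp2F1 (- real n) (real n + 2 * real (j + 1)) (real (j + 1) + 1 / 2) ((1 - u) / 2) = (\<Sum>m\<le>n. ?h m)"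
    unfolding hyp2F1_def by (intro suminf_finite) (auto simp: pochhammer_of_nat_eq_0_lemma)
  then have geg: "gegenbauer (j + 1) n u = (\<Sum>m\<le>n. real ((n + 2 * j + 1) choose n) * ?h m)"
    by (simp add: gegenbauer_def sum_distrib_left)
  have "2 ^ j * fact j * gegenbauer (j + 1) n u = (\<Sum>m\<le>n. 2 ^ j * fact (j + m) / fact m
      * real ((k + j + m + 1) choose (2 * (j + m) + 1)) * (2 * u - 2) ^ m)"
    unfolding geg sum_distrib_left
  proof (intro sum.cong refl)
    fix m assume "m \<in> {..n}"
    then have m: "m \<le> n" by simp
    have y: "(- 4) ^ m * ((1 - u) / 2) ^ m = (2 * u - 2) ^ m"
      by (simp add: power_mult_distrib[symmetric] field_simps)
    have b: "(n + 2 * j + m + 1) choose (n - m) = (k + j + m + 1) choose (2 * (j + m) + 1)"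
    proof -
      have "n + 2 * j + m + 1 = k + j + m + 1" by (simp add: k)
      moreover have "k + j + m + 1 - (n - m) = 2 * (j + m) + 1" "n - m \<le> k + j + m + 1"
        using m by (auto simp: k)
      ultimately show ?thesis by (metis binomial_symmetric)
    qed
    have g: "real ((n + 2 * j + 1) choose n) * (pochhammer (- real n) m * pochhammer (real n + 2 * real (j + 1)) m
      / (pochhammer (real (j + 1) + 1 / 2) m * fact m))
      = (- 4) ^ m * (fact (j + m) / (fact j * fact m)) * real ((k + j + m + 1) choose (2 * (j + m) + 1))"
      using gegenbauer_coeff[OF m, of j] unfolding b by (simp add: algebra_simps)
    have "2 ^ j * fact j * (real ((n + 2 * j + 1) choose n) * ?h m)
      = 2 ^ j * fact j * ((real ((n + 2 * j + 1) choose n) * (pochhammer (- real n) m * pochhammer (real n + 2 * real (j + 1)) m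
      / (pochhammer (real (j + 1) + 1 / 2) m * fact m))) * ((1 - u) / 2) ^ m)"
      by (simp only: mult.assoc)
    also have "\<dots> = 2 ^ j * fact (j + m) / fact m * real ((k + j + m + 1) choose (2 * (j + m) + 1))
        * ((- 4) ^ m * ((1 - u) / 2) ^ m)"
      unfolding g by (simp add: mult_ac)
    finally show "2 ^ j * fact j * (real ((n + 2 * j + 1) choose n) * ?h m)
      = 2 ^ j * fact (j + m) / fact m * real ((k + j + m + 1) choose (2 * (j + m) + 1)) * (2 * u - 2) ^ m"
      unfolding y .
  qed
  also have "\<dots> = W j k u"
    unfolding W_expansion
  proof (rule sum.mono_neutral_left)
    show "{..n} \<subseteq> {..k}" by (simp add: k)
    show "\<forall>m\<in>{..k} - {..n}. 2 ^ j * fact (j + m) / fact m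
      * real ((k + j + m + 1) choose (2 * (j + m) + 1)) * (2 * u - 2) ^ m = 0"
    proof
      fix m assume "m \<in> {..k} - {..n}"
      then have "k + j + m + 1 < 2 * (j + m) + 1" by (simp add: k)
      then show "2 ^ j * fact (j + m) / fact m
          * real ((k + j + m + 1) choose (2 * (j + m) + 1)) * (2 * u - 2) ^ m = 0"
        by (simp only: binomial_eq_0 of_nat_0 mult_zero_left mult_zero_right)
    qed
  qed simp
  finally show ?thesis unfolding n_def .
qed

section \<open>The entries of the intertwining matrix\<close>

text \<open>
  The derivatives of \<open>U\<^sub>k\<close> with the factorials of \<open>\<Psi>\<close> included. In this normalisation the contiguity
  relations take the coefficients that occur in the matrices \<open>S\<^sub>1\<close>, \<open>R\<^sub>1\<close> and \<open>R\<^sub>2\<close>.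
\<close>

definition phi :: "nat \<Rightarrow> nat \<Rightarrow> real \<Rightarrow> real" where
  "phi j k u = fact k / fact (k + j + 1) * W j k u"

lemma phi_gegenbauer:
  assumes "j \<le> k"
  shows "phi j k u = 2 ^ j * fact k * fact j / fact (k + j + 1) * gegenbauer (j + 1) (k - j) u"
  using W_gegenbauer[OF assms, of u, symmetric] by (simp add: phi_def)

lemma phi_eq_0: "k < j \<Longrightarrow> phi j k u = 0"
  by (simp add: phi_def W_eq_0)

lemma phi_diag_nonzero: "phi j j u \<noteq> 0"
proof -
  have "W j j u = (\<Sum>m\<in>{0}. 2 ^ j * fact (j + m) / fact m
      * real ((j + j + m + 1) choose (2 * (j + m) + 1)) * (2 * u - 2) ^ m)"
    unfolding W_expansion by (intro sum.mono_neutral_right) (auto simp: binomial_eq_0)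
  also have "\<dots> = 2 ^ j * fact j * real ((j + j + 1) choose (2 * j + 1))"
    by simp
  finally have "W j j u = 2 ^ j * fact j * real ((2 * j + 1) choose (2 * j + 1))"
    by (simp only: mult_2)
  then have "W j j u = 2 ^ j * fact j"
    by (simp only: binomial_n_n of_nat_1 mult_1_right)
  then show ?thesis by (simp add: phi_def)
qed

text \<open>
  Raising \<open>j\<close> at fixed \<open>k\<close>, or \<open>k\<close> at fixed \<open>j\<close>, leads to the same denominator. Each relation for \<open>W\<close> is
  therefore carried over to \<open>phi\<close> by writing every term as a multiple of one common constant \<open>c\<close>.
\<close>

lemma phi_normalisation:
  "fact k / fact (k + j + 1) = (real k + real j + 2) * (fact k / fact (k + Suc j + 1))"
  "fact (Suc k) / fact (Suc k + j + 1) = (real k + 1) * (fact k / fact (k + Suc j + 1))"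
proof -
  have "fact (k + Suc j + 1) = (real k + real j + 2) * fact (k + j + 1)"
    by (simp add: algebra_simps)
  then show "fact k / fact (k + j + 1) = (real k + real j + 2) * (fact k / fact (k + Suc j + 1))"
    by (simp del: fact_Suc add: add_nonneg_eq_0_iff)
  have "fact (Suc k) = (real k + 1) * fact k" "Suc k + j + 1 = k + Suc j + 1"
    by (simp_all add: algebra_simps)
  then show "fact (Suc k) / fact (Suc k + j + 1) = (real k + 1) * (fact k / fact (k + Suc j + 1))"
    by (simp only: times_divide_eq_right)
qed

lemma phi_deriv: "(phi j k has_real_derivative (real k + real j + 2) * phi (Suc j) k u) (at u)"
proof -
  have "(W j k has_real_derivative W (Suc j) k u) (at u)"
    unfolding W_def[abs_def] pderiv_dU[symmetric] by (rule poly_DERIV)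
  then have "(phi j k has_real_derivative fact k / fact (k + j + 1) * W (Suc j) k u) (at u)"
    unfolding phi_def[abs_def] by (rule DERIV_cmult)
  then show ?thesis
    unfolding phi_normalisation(1)[of k j] by (simp only: phi_def mult.assoc)
qed

text \<open>
  For \<open>k = 0\<close> the factor \<open>real k\<close> removes the term with \<open>k - 1\<close>; this is also how the missing column to the
  left of the first one disappears from the matrix identities.
\<close>

lemma phi_deriv_down:
  "(real k + real j + 2) * ((1 - u\<^sup>2) * phi (Suc j) k u)
     = real k * phi j (k - 1) u - (real k - real j) * (u * phi j k u)"
proof (cases k)
  case 0
  then show ?thesis by (cases j) (simp_all add: phi_eq_0)
next
  case (Suc i)
  define c where "c = fact i / (fact (i + Suc (Suc j) + 1) :: real)"
  have phi: "phi (Suc j) (Suc i) u = (real i + 1) * c * W (Suc j) (Suc i) u"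
    "phi j (Suc i) u = (real i + 1) * (real i + real j + 3) * c * W j (Suc i) u"
    "phi j i u = (real i + real j + 2) * (real i + real j + 3) * c * W j i u"
    unfolding phi_def phi_normalisation(2) phi_normalisation(1)[of i j]
      phi_normalisation(1)[of i "Suc j"] c_def[symmetric] by simp_all
  have "(1 - u\<^sup>2) * W (Suc j) (Suc i) u = (real i + 2 + real j) * W j i u - (real i + 1 - real j) * (u * W j (Suc i) u)"
  proof -
    have "W (Suc j) (Suc i) u = u * (u * W (Suc j) (Suc i) u - (real i + 1 - real j) * W j (Suc i) u)
        + (real i + 2 + real j) * W j i u"
      using W_lower[of j i u] W_raise[of j i u] by simp
    then show ?thesis by (simp add: algebra_simps power2_eq_square)
  qed
  then have *: "(1 - u\<^sup>2) * phi (Suc j) (Suc i) u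
      = (real i + 1) * c * ((real i + 2 + real j) * W j i u - (real i + 1 - real j) * (u * W j (Suc i) u))"
    unfolding phi by (metis mult.left_commute)
  show ?thesis
    unfolding Suc diff_Suc_1 * unfolding phi by (simp add: algebra_simps)
qed

lemma phi_deriv_up:
  "(1 - u\<^sup>2) * phi (Suc j) k u = u * phi j k u - (real k + 1 - real j) * (phi j (Suc k) u / (real k + 1))"
proof -
  define c where "c = fact k / (fact (k + Suc j + 1) :: real)"
  have phi: "phi (Suc j) k u = c * W (Suc j) k u"
    "phi j k u = (real k + real j + 2) * c * W j k u"
    "phi j (Suc k) u = (real k + 1) * (c * W j (Suc k) u)"
    unfolding phi_def phi_normalisation(2) phi_normalisation(1)[of k j] c_def[symmetric] by simp_all
  have cancel: "(real k + 1) * x / (real k + 1) = x" for x by simp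
  show ?thesis
    unfolding phi cancel using arg_cong[OF W_deriv_up[of u j k], of "\<lambda>x. c * x"]
    by (simp add: algebra_simps)
qed

lemma phi_ode:
  "(real k + real j + 3) * ((1 - u\<^sup>2) * phi (Suc (Suc j)) k u)
     = (2 * real j + 3) * (u * phi (Suc j) k u) - (real k - real j) * phi j k u"
proof -
  define c where "c = fact k / (fact (k + Suc (Suc j) + 1) :: real)"
  have phi: "phi (Suc (Suc j)) k u = c * W (Suc (Suc j)) k u"
    "phi (Suc j) k u = (real k + real j + 3) * c * W (Suc j) k u"
    "phi j k u = (real k + real j + 2) * (real k + real j + 3) * c * W j k u"
    unfolding phi_def phi_normalisation(1)[of k j] phi_normalisation(1)[of k "Suc j"] c_def[symmetric]
    by simp_all
  show ?thesis
    unfolding phi using arg_cong[OF W_ode[of u j k], of "\<lambda>x. (real k + real j + 3) * c * x"]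
    by (simp add: algebra_simps)
qed

lemma phi_raise:
  "phi j k u = (real k + real j + 3) * (phi (Suc j) (Suc k) u / (real k + 1)) - u * phi (Suc j) k u"
proof -
  define c where "c = fact k / (fact (k + Suc (Suc j) + 1) :: real)"
  have phi: "phi (Suc j) (Suc k) u = (real k + 1) * (c * W (Suc j) (Suc k) u)"
    "phi (Suc j) k u = (real k + real j + 3) * c * W (Suc j) k u"
    "phi j k u = (real k + real j + 2) * (real k + real j + 3) * c * W j k u"
    unfolding phi_def phi_normalisation(2) phi_normalisation(1)[of k j] phi_normalisation(1)[of k "Suc j"] c_def[symmetric]
    by simp_all
  have cancel: "(real k + 1) * x / (real k + 1) = x" for x by simp
  show ?thesis
    unfolding phi cancel using arg_cong[OF W_raise[of j k u], of "\<lambda>x. (real k + real j + 3) * c * x"]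
    by (simp add: algebra_simps)
qed

text \<open>The Gegenbauer recurrence in the degree, from the two expressions for \<open>(1 - u\<^sup>2) \<phi>'\<^sub>j\<^sub>k\<close>.\<close>

lemma phi_three_term:
  "real k * phi j (k - 1) u
     = 2 * (real k + 1) * (u * phi j k u)
       - (real k + 1 - real j) * (real k + real j + 2) * (phi j (Suc k) u / (real k + 1))"
proof -
  define r where "r = phi j (Suc k) u / (real k + 1)"
  show ?thesis
    using phi_deriv_down[of k j u] unfolding phi_deriv_up r_def[symmetric] by (simp add: algebra_simps)
qed

text \<open>
  The entry \<open>(j, k)\<close> of \<open>A \<Psi> = \<Psi> (u R\<^sub>2 + R\<^sub>1)\<close>. Every term is a combination of \<open>u \<phi>\<^sub>j\<^sub>k\<close> and
  \<open>r = \<phi>\<^sub>j\<^sub>,\<^sub>k\<^sub>+\<^sub>1 / (k + 1)\<close>, so it suffices to compare two coefficients.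
\<close>

lemma phi_E_first_order:
  "(real j + 1) * (real l + real j + 2) * ((1 - u\<^sup>2) * phi (Suc j) k u)
       - real j * (real l - real j + 1) * phi (j - 1) k u
     = (2 * real j + 1) * ((real l - 2 * real k) * (u * phi j k u) + real k * phi j (k - 1) u
         - (real l - real k) * phi j (Suc k) u)"
proof -
  define r where "r = phi j (Suc k) u / (real k + 1)"
  have q: "phi j (Suc k) u = (real k + 1) * r" by (simp add: r_def)
  have p: "real j * phi (j - 1) k u = real j * ((real k + real j + 2) * r - u * phi j k u)"
    unfolding r_def using phi_raise[of "j - 1" k u] by (cases j) auto
  have "real j * (real l - real j + 1) * phi (j - 1) k u
      = (real l - real j + 1) * (real j * phi (j - 1) k u)" by simp
  also have "\<dots> = (real l - real j + 1) * (real j * ((real k + real j + 2) * r - u * phi j k u))"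
    by (simp only: p)
  finally have p': "real j * (real l - real j + 1) * phi (j - 1) k u = \<dots>" .
  show ?thesis
    unfolding phi_deriv_up phi_three_term p' r_def[symmetric]
    unfolding q by (simp add: algebra_simps)
qed

text \<open>
  The entry \<open>(j, k)\<close> of the zeroth order identity for the first order operator. The differential equation
  eliminates both shifted functions, which leaves a polynomial identity in \<open>j\<close>, \<open>k\<close> and \<open>l\<close>.
\<close>

lemma phi_E_order_zero:
  "(real j + 1) * (real l + real j + 2) * ((real k + real j + 3) * ((1 - u\<^sup>2) * phi (Suc (Suc j)) k u))
     - real j * (real l - real j + 1) * ((real k + real j + 1) * phi j k u)
     - (2 * real j + 3) * ((real j + 1) * (real l + real j + 2)) * (u * phi (Suc j) k u)
     - real j * (real j + 1) * ((2 * real j + 1) * phi j k u)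
   = - (real k * (real l + 2)) * ((2 * real j + 1) * phi j k u)"
  unfolding phi_ode by (simp add: algebra_simps)

section \<open>Products with tridiagonal matrices\<close>

lemma sum_if_eq_Suc:
  fixes f :: "nat \<Rightarrow> 'a::comm_monoid_add"
  shows "(\<Sum>i\<in>{0..<n}. if j = Suc i then f i else 0) = (if 0 < j \<and> j \<le> n then f (j - 1) else 0)"
proof (cases j)
  case 0
  then show ?thesis by simp
next
  case (Suc m)
  have "(\<Sum>i\<in>{0..<n}. if j = Suc i then f i else 0) = (\<Sum>i\<in>{0..<n}. if i = m then f i else 0)"
    unfolding Suc by (intro sum.cong) auto
  then show ?thesis by (simp add: Suc)
qed

context
  fixes n :: nat and B :: "'a :: comm_semiring_0 mat"
  assumes B: "B \<in> carrier_mat n n"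
begin

lemma index_diag_mult:
  assumes "j < n" "k < n"
  shows "(mat n n (\<lambda>(j, k). if k = j then d j else 0) * B) $$ (j, k) = d j * B $$ (j, k)"
  using assms B by (simp add: scalar_prod_def if_distrib[of "\<lambda>x. x * _"] cong: if_cong)

lemma index_mult_diag:
  assumes "j < n" "k < n"
  shows "(B * mat n n (\<lambda>(j, k). if k = j then d j else 0)) $$ (j, k) = d k * B $$ (j, k)"
  using assms B by (simp add: scalar_prod_def if_distrib[of "\<lambda>x. _ * x"] mult.commute cong: if_cong)

lemma index_super_mult:
  assumes "j < n" "k < n"
  shows "(mat n n (\<lambda>(j, k). if k = j + 1 then s j else 0) * B) $$ (j, k)
    = (if j + 1 < n then s j * B $$ (j + 1, k) else 0)"
  using assms B by (simp add: scalar_prod_def if_distrib[of "\<lambda>x. x * _"] cong: if_cong)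

lemma index_sub_mult:
  assumes "j < n" "k < n"
  shows "(mat n n (\<lambda>(j, k). if j = k + 1 then t j else 0) * B) $$ (j, k)
    = (if 0 < j then t j * B $$ (j - 1, k) else 0)"
  using assms B by (simp add: scalar_prod_def if_distrib[of "\<lambda>x. x * _"] sum_if_eq_Suc cong: if_cong)

lemma index_mult_super:
  assumes "j < n" "k < n"
  shows "(B * mat n n (\<lambda>(j, k). if k = j + 1 then s j else 0)) $$ (j, k)
    = (if 0 < k then s (k - 1) * B $$ (j, k - 1) else 0)"
  using assms B by (simp add: scalar_prod_def if_distrib[of "\<lambda>x. _ * x"] sum_if_eq_Suc mult.commute cong: if_cong)

lemma index_mult_super_sub:
  assumes "j < n" "k < n"
  shows "(B * mat n n (\<lambda>(j, k). if k = j + 1 then s j else if j = k + 1 then t k else 0)) $$ (j, k)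
    = (if 0 < k then s (k - 1) * B $$ (j, k - 1) else 0)
      + (if k + 1 < n then t k * B $$ (j, k + 1) else 0)"
proof -
  have "(B * mat n n (\<lambda>(j, k). if k = j + 1 then s j else if j = k + 1 then t k else 0)) $$ (j, k)
    = (\<Sum>i\<in>{0..<n}. (if k = Suc i then s i * B $$ (j, i) else 0)
        + (if i = k + 1 then t k * B $$ (j, i) else 0))"
    using assms B by (auto simp: scalar_prod_def mult.commute intro!: sum.cong)
  then show ?thesis
    using assms by (simp add: sum.distrib sum_if_eq_Suc)
qed

end

text \<open>
  The part of the entries of \<open>\<Psi>\<close> that depends on the row alone. It makes the factors \<open>i\<close> and the odd denominators
  of \<open>Q\<^sub>0\<close> and \<open>Q\<^sub>1\<close> cancel, and leaves real identities for \<open>phi\<close>.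
\<close>

definition kappa :: "nat \<Rightarrow> complex" where
  "kappa j = (2 * of_nat j + 1) * (- \<i>) ^ j"

lemma odd_nonzero: "(2 * of_nat j + 1 :: complex) \<noteq> 0"
  using of_nat_eq_0_iff[of "2 * j + 1", where 'a = complex]
  by (simp del: of_nat_eq_0_iff add: add.commute)

lemma kappa_step:
  "\<i> / (2 * of_nat j + 3) * kappa (Suc j) = kappa j / (2 * of_nat j + 1)"
  "\<i> / (2 * of_nat j + 1) * kappa j = - (kappa (Suc j) / (2 * of_nat j + 3))"
proof -
  have nz: "(2 * of_nat j + 3 :: complex) \<noteq> 0"
    using of_nat_eq_0_iff[of "2 * j + 3", where 'a = complex]
    by (simp del: of_nat_eq_0_iff add: add.commute)
  have k: "kappa j = (2 * of_nat j + 1) * (- \<i>) ^ j"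
    "kappa (Suc j) = (2 * of_nat j + 3) * (- \<i> * (- \<i>) ^ j)"
    by (simp_all add: kappa_def algebra_simps)
  show "\<i> / (2 * of_nat j + 3) * kappa (Suc j) = kappa j / (2 * of_nat j + 1)"
    unfolding k using nz odd_nonzero[of j] by simp
  show "\<i> / (2 * of_nat j + 1) * kappa j = - (kappa (Suc j) / (2 * of_nat j + 3))"
    unfolding k using nz odd_nonzero[of j] by simp
qed

lemma kappa_cancel:
  "kappa j / (2 * (2 * of_nat j + 1)) * of_real ((2 * real j + 1) * y) = kappa j / 2 * of_real y"
proof -
  have d: "of_real (2 * real j + 1) = (2 * of_nat j + 1 :: complex)" by simp
  have "a / (2 * d) * (d * z) = a / 2 * z" if "d \<noteq> 0" for a d z :: complex
    using that by simp
  from this[OF odd_nonzero] show ?thesis unfolding of_real_mult d .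
qed

lemma kappa_nonzero: "kappa j \<noteq> 0"
  using odd_nonzero by (simp add: kappa_def)

lemma Psi_eq_phi: "Psi l u = mat (l + 1) (l + 1) (\<lambda>(j, k). kappa j * of_real (phi j k u))"
proof (rule eq_matI)
  fix j k assume "j < dim_row (mat (l + 1) (l + 1) (\<lambda>(j, k). kappa j * of_real (phi j k u)))"
    and "k < dim_col (mat (l + 1) (l + 1) (\<lambda>(j, k). kappa j * of_real (phi j k u)))"
  then have jk: "j < l + 1" "k < l + 1" by simp_all
  show "Psi l u $$ (j, k) = mat (l + 1) (l + 1) (\<lambda>(j, k). kappa j * of_real (phi j k u)) $$ (j, k)"
  proof (cases "j \<le> k")
    case True
    have "(- 2 * \<i>) ^ j = (- \<i>) ^ j * 2 ^ j"
      by (metis mult.commute mult_minus_right power_mult_distrib)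
    then have "Psi l u $$ (j, k) = (2 * of_nat j + 1) * ((- \<i>) ^ j * 2 ^ j) * fact k * fact j / fact (k + j + 1)
        * of_real (gegenbauer (j + 1) (k - j) u)"
      using True jk by (simp add: Psi_def)
    also have "\<dots> = kappa j * of_real (phi j k u)"
      unfolding phi_gegenbauer[OF True] kappa_def by simp
    finally show ?thesis using jk by simp
  qed (use jk in \<open>simp add: Psi_def phi_eq_0\<close>)
qed (simp_all add: Psi_def)

text \<open>The first two derivatives of \<open>\<Psi>\<close> with respect to \<open>u\<close>, taken by entries.\<close>

definition Psi' :: "nat \<Rightarrow> real \<Rightarrow> complex mat" where
  "Psi' l u = mat (l + 1) (l + 1) (\<lambda>(j, k). kappa j * of_real ((real k + real j + 2) * phi (Suc j) k u))"

definition Psi'' :: "nat \<Rightarrow> real \<Rightarrow> complex mat" where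
  "Psi'' l u = mat (l + 1) (l + 1) (\<lambda>(j, k).
     kappa j * of_real ((real k + real j + 2) * ((real k + real j + 3) * phi (Suc (Suc j)) k u)))"

lemma Psi_carrier [simp]:
  "Psi l u \<in> carrier_mat (Suc l) (Suc l)" "Psi' l u \<in> carrier_mat (Suc l) (Suc l)"
  "Psi'' l u \<in> carrier_mat (Suc l) (Suc l)"
  by (simp_all add: Psi_def Psi'_def Psi''_def)

lemma coeff_carrier [simp]:
  "C_mat l \<in> carrier_mat (Suc l) (Suc l)" "V_mat l \<in> carrier_mat (Suc l) (Suc l)"
  "Q0_mat l \<in> carrier_mat (Suc l) (Suc l)" "Q1_mat l \<in> carrier_mat (Suc l) (Suc l)"
  "M_mat l \<in> carrier_mat (Suc l) (Suc l)" "V0_mat l \<in> carrier_mat (Suc l) (Suc l)"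
  "S1_mat l \<in> carrier_mat (Suc l) (Suc l)" "R1_mat l \<in> carrier_mat (Suc l) (Suc l)"
  "R2_mat l \<in> carrier_mat (Suc l) (Suc l)" "Lambda0_mat l \<in> carrier_mat (Suc l) (Suc l)"
  "M0_mat l \<in> carrier_mat (Suc l) (Suc l)"
  by (simp_all add: C_mat_def V_mat_def Q0_mat_def Q1_mat_def M_mat_def V0_mat_def S1_mat_def
      R1_mat_def R2_mat_def Lambda0_mat_def M0_mat_def)

lemmas matrix_dims [simp] =
  Psi_carrier[THEN carrier_matD(1)] Psi_carrier[THEN carrier_matD(2)]
  coeff_carrier[THEN carrier_matD(1)] coeff_carrier[THEN carrier_matD(2)]

lemma Psi_index:
  assumes "j < Suc l" "k < Suc l"
  shows "Psi l u $$ (j, k) = kappa j * of_real (phi j k u)"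
    "Psi' l u $$ (j, k) = kappa j * of_real ((real k + real j + 2) * phi (Suc j) k u)"
    "Psi'' l u $$ (j, k)
      = kappa j * of_real ((real k + real j + 2) * ((real k + real j + 3) * phi (Suc (Suc j)) k u))"
  using assms by (simp_all add: Psi_eq_phi Psi'_def Psi''_def)

context
  fixes l :: nat and B :: "complex mat"
  assumes B: "B \<in> carrier_mat (Suc l) (Suc l)"
begin

context
  fixes j k :: nat
  assumes jk: "j < Suc l" "k < Suc l"
begin

lemma index_coeff_mult:
  "(C_mat l * B) $$ (j, k) = (2 * of_nat j + 3) * B $$ (j, k)"
  "(V_mat l * B) $$ (j, k) = of_nat j * (of_nat j + 2) * B $$ (j, k)"
  "(V0_mat l * B) $$ (j, k) = of_nat j * (of_nat j + 1) * B $$ (j, k)"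
  "(Q0_mat l * B) $$ (j, k) = (if j < l
     then (of_nat j + 1) * (of_nat l + of_nat j + 2) / (2 * of_nat j + 3) * B $$ (Suc j, k) else 0)"
  "(M_mat l * B) $$ (j, k) = (if j < l
     then (of_nat j + 1) * (of_nat l + of_nat j + 2) * B $$ (Suc j, k) else 0)"
  "(Q1_mat l * B) $$ (j, k) = (if 0 < j
     then of_nat j * (of_nat l - of_nat j + 1) / (2 * of_nat j - 1) * B $$ (j - 1, k) else 0)"
  using index_diag_mult[OF B jk] index_super_mult[OF B jk] index_sub_mult[OF B jk]
  unfolding C_mat_def V_mat_def V0_mat_def Q0_mat_def M_mat_def Q1_mat_def
  by (simp_all del: index_mult_mat)

lemma index_mult_coeff:
  "(B * C_mat l) $$ (j, k) = (2 * of_nat k + 3) * B $$ (j, k)"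
  "(B * Lambda0_mat l) $$ (j, k) = - of_nat k * (of_nat k + 2) * B $$ (j, k)"
  "(B * M0_mat l) $$ (j, k) = - of_nat k * (of_nat l / 2 + 1) * B $$ (j, k)"
  "(B * R2_mat l) $$ (j, k) = (of_nat l / 2 - of_nat k) * B $$ (j, k)"
  "(B * S1_mat l) $$ (j, k) = (if 0 < k then 2 * of_nat k * B $$ (j, k - 1) else 0)"
  "(B * R1_mat l) $$ (j, k) = (if 0 < k then of_nat k / 2 * B $$ (j, k - 1) else 0)
     - (if k < l then (of_nat l - of_nat k) / 2 * B $$ (j, Suc k) else 0)"
  using index_mult_diag[OF B jk] index_mult_super[OF B jk] index_mult_super_sub[OF B jk]
  unfolding C_mat_def Lambda0_mat_def M0_mat_def R2_mat_def S1_mat_def R1_mat_def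
  by (cases k; simp del: index_mult_mat; fail)+

end

end

section \<open>Intertwining identities\<close>

lemma D_intertwining_order_0:
  "of_real (1 - u\<^sup>2) \<cdot>\<^sub>m Psi'' l u - of_real u \<cdot>\<^sub>m (C_mat l * Psi' l u) - V_mat l * Psi l u
     = Psi l u * Lambda0_mat l" (is "?L = ?R")
proof (rule eq_matI)
  fix j k assume "j < dim_row ?R" "k < dim_col ?R"
  then have jk: "j < Suc l" "k < Suc l" by simp_all
  let ?lhs = "(1 - u\<^sup>2) * ((real k + real j + 2) * ((real k + real j + 3) * phi (Suc (Suc j)) k u))
      - u * ((2 * real j + 3) * ((real k + real j + 2) * phi (Suc j) k u)) - real j * (real j + 2) * phi j k u"
  have "?L $$ (j, k) = kappa j * of_real ?lhs"
    using jk
    by (simp add: index_coeff_mult index_mult_coeff Psi_index del: index_mult_mat(1)) (simp add: algebra_simps)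
  also have "?lhs = - (real k * (real k + 2)) * phi j k u"
    using arg_cong[OF phi_ode[of k j u], of "\<lambda>x. (real k + real j + 2) * x"]
    by (simp add: algebra_simps)
  also have "kappa j * of_real \<dots> = ?R $$ (j, k)"
    using jk
    by (simp add: index_coeff_mult index_mult_coeff Psi_index del: index_mult_mat(1))
  finally show "?L $$ (j, k) = ?R $$ (j, k)" .
qed simp_all

lemma D_intertwining_order_1:
  "of_real (2 * (1 - u\<^sup>2)) \<cdot>\<^sub>m Psi' l u - of_real u \<cdot>\<^sub>m (C_mat l * Psi l u)
     = Psi l u * (- of_real u \<cdot>\<^sub>m C_mat l + S1_mat l)" (is "?L = ?R")
proof (rule eq_matI)
  fix j k assume "j < dim_row ?R" "k < dim_col ?R"
  then have jk: "j < Suc l" "k < Suc l" by simp_all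
  let ?lhs = "2 * (1 - u\<^sup>2) * ((real k + real j + 2) * phi (Suc j) k u)
      - u * ((2 * real j + 3) * phi j k u)"
  have "?L $$ (j, k) = kappa j * of_real ?lhs"
    using jk
    by (simp add: index_coeff_mult index_mult_coeff Psi_index del: index_mult_mat(1)) (simp add: algebra_simps)
  also have "?lhs = - u * ((2 * real k + 3) * phi j k u) + 2 * (real k * phi j (k - 1) u)"
    using phi_deriv_down[of k j u] by (simp add: algebra_simps)
  also have "kappa j * of_real \<dots> = ?R $$ (j, k)"
  proof -
    have "?R = - of_real u \<cdot>\<^sub>m (Psi l u * C_mat l) + Psi l u * S1_mat l"
      by (simp add: mult_add_distrib_mat[of _ "Suc l" "Suc l" _ "Suc l"] mult_smult_distrib[of _ "Suc l" "Suc l" _ "Suc l"])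
    also have "\<dots> $$ (j, k) = kappa j * of_real (- u * ((2 * real k + 3) * phi j k u) + 2 * (real k * phi j (k - 1) u))"
      using jk
      by (cases k) (simp_all add: index_mult_coeff Psi_index algebra_simps del: index_mult_mat(1))
    finally show ?thesis by simp
  qed
  finally show "?L $$ (j, k) = ?R $$ (j, k)" .
qed simp_all

text \<open>
  Both \<open>\<Psi>\<close> and \<open>\<Psi>'\<close> have entries of the form \<open>kappa i * x i\<close> in each column, so the leading coefficient of the
  first order operator is applied to both at once. The matrix \<open>Q\<^sub>0\<close> has no entry beyond the last row;
  the formula without a case distinction is right because \<open>x\<close> vanishes there, the degree
  \<open>k \<le> l\<close> being used up after \<open>l + 1\<close> derivatives.
\<close>

context
  fixes l j k :: nat and B :: "complex mat" and x :: "nat \<Rightarrow> real"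
  assumes B: "B \<in> carrier_mat (Suc l) (Suc l)" and jk: "j < Suc l" "k < Suc l"
    and entry: "\<And>i. i < Suc l \<Longrightarrow> B $$ (i, k) = kappa i * of_real (x i)"
    and top: "x (Suc l) = 0"
begin

lemma index_Q0_mult:
  "\<i> / 2 * (Q0_mat l * B) $$ (j, k)
     = kappa j / (2 * (2 * of_nat j + 1)) * of_real ((real j + 1) * (real l + real j + 2) * x (Suc j))"
proof (cases "j < l")
  case True
  then have *: "\<i> / 2 * (Q0_mat l * B) $$ (j, k)
      = (\<i> / (2 * of_nat j + 3) * kappa (Suc j)) * ((of_nat j + 1) * (of_nat l + of_nat j + 2) * of_real (x (Suc j))) / 2"
    by (simp add: index_coeff_mult[OF B jk] entry del: index_mult_mat(1))
  show ?thesis unfolding * kappa_step by simp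
next
  case False
  then have "x (Suc j) = 0" using jk top by (metis less_antisym)
  with False show ?thesis by (simp add: index_coeff_mult[OF B jk] del: index_mult_mat(1))
qed

lemma index_Q1_mult:
  "\<i> / 2 * (Q1_mat l * B) $$ (j, k)
     = - (kappa j / (2 * (2 * of_nat j + 1)) * of_real (real j * (real l - real j + 1) * x (j - 1)))"
proof (cases j)
  case 0
  then show ?thesis using index_coeff_mult(6)[OF B jk] by (simp del: index_mult_mat(1))
next
  case (Suc i)
  have *: "\<i> / 2 * (Q1_mat l * B) $$ (j, k)
      = (\<i> / (2 * of_nat i + 1) * kappa i) * (of_nat j * (of_nat l - of_nat j + 1) * of_real (x i)) / 2"
  proof -
    have d: "2 * of_nat j - 1 = (2 * of_nat i + 1 :: complex)" using Suc by simp
    show ?thesis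
      unfolding index_coeff_mult(6)[OF B jk] d using Suc jk entry[of i] by simp
  qed
  show ?thesis unfolding * kappa_step using Suc by (simp add: add_ac)
qed

lemma index_M_mult:
  "\<i> / 2 * (M_mat l * B) $$ (j, k)
     = kappa j / (2 * (2 * of_nat j + 1))
       * of_real ((2 * real j + 3) * ((real j + 1) * (real l + real j + 2)) * x (Suc j))"
proof (cases "j < l")
  case True
  have "(2 * of_nat j + 3 :: complex) \<noteq> 0"
    using of_nat_eq_0_iff[of "2 * j + 3", where 'a = complex]
    by (simp del: of_nat_eq_0_iff add: add.commute)
  with True have *: "\<i> / 2 * (M_mat l * B) $$ (j, k)
      = (\<i> / (2 * of_nat j + 3) * kappa (Suc j)) * ((2 * of_nat j + 3) * ((of_nat j + 1) * (of_nat l + of_nat j + 2)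
          * of_real (x (Suc j)))) / 2"
    by (simp add: index_coeff_mult[OF B jk] entry del: index_mult_mat(1))
  show ?thesis unfolding * kappa_step by simp
next
  case False
  then have "x (Suc j) = 0" using jk top by (metis less_antisym)
  with False show ?thesis by (simp add: index_coeff_mult[OF B jk] del: index_mult_mat(1))
qed

lemma index_E_leading:
  "((\<i> / 2) \<cdot>\<^sub>m ((of_real a \<cdot>\<^sub>m Q0_mat l + Q1_mat l) * B)) $$ (j, k)
     = kappa j / (2 * (2 * of_nat j + 1)) * of_real
        (a * ((real j + 1) * (real l + real j + 2) * x (Suc j)) - real j * (real l - real j + 1) * x (j - 1))"
proof -
  let ?X = "\<i> / 2 * (Q0_mat l * B) $$ (j, k)" and ?Y = "\<i> / 2 * (Q1_mat l * B) $$ (j, k)"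
  have "(of_real a \<cdot>\<^sub>m Q0_mat l + Q1_mat l) * B = of_real a \<cdot>\<^sub>m (Q0_mat l * B) + Q1_mat l * B"
    using B by (simp add: add_mult_distrib_mat[of _ "Suc l" "Suc l" _ _ "Suc l"]
        mult_smult_assoc_mat[of _ "Suc l" "Suc l" _ "Suc l"])
  then have "((\<i> / 2) \<cdot>\<^sub>m ((of_real a \<cdot>\<^sub>m Q0_mat l + Q1_mat l) * B)) $$ (j, k)
      = \<i> / 2 * (of_real a * (Q0_mat l * B) $$ (j, k) + (Q1_mat l * B) $$ (j, k))"
    using B jk by (simp del: index_mult_mat(1))
  also have "\<dots> = of_real a * ?X + ?Y"
    by (simp only: distrib_left mult.left_commute)
  also have "\<dots> = kappa j / (2 * (2 * of_nat j + 1)) * of_real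
        (a * ((real j + 1) * (real l + real j + 2) * x (Suc j)) - real j * (real l - real j + 1) * x (j - 1))"
    unfolding index_Q0_mult index_Q1_mult of_real_diff of_real_mult[of a] right_diff_distrib
    by (simp only: mult.left_commute add_uminus_conv_diff)
  finally show ?thesis .
qed

end

lemma E_intertwining_order_1:
  "(\<i> / 2) \<cdot>\<^sub>m ((of_real (1 - u\<^sup>2) \<cdot>\<^sub>m Q0_mat l + Q1_mat l) * Psi l u)
     = Psi l u * (of_real u \<cdot>\<^sub>m R2_mat l + R1_mat l)" (is "?L = ?R")
proof (rule eq_matI)
  fix j k assume "j < dim_row ?R" "k < dim_col ?R"
  then have jk: "j < Suc l" "k < Suc l" by simp_all
  let ?rhs = "(real l - 2 * real k) * (u * phi j k u) + real k * phi j (k - 1) u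
         - (real l - real k) * phi j (Suc k) u"
  let ?c = "kappa j / (2 * (2 * of_nat j + 1))"
  have "?L $$ (j, k) = ?c * of_real ((1 - u\<^sup>2) * ((real j + 1) * (real l + real j + 2) * phi (Suc j) k u)
      - real j * (real l - real j + 1) * phi (j - 1) k u)"
    using jk by (intro index_E_leading Psi_index(1)) (auto simp: phi_eq_0)
  also have "(1 - u\<^sup>2) * ((real j + 1) * (real l + real j + 2) * phi (Suc j) k u)
      - real j * (real l - real j + 1) * phi (j - 1) k u = (2 * real j + 1) * ?rhs"
    using phi_E_first_order[of j l u k] by (simp only: mult.left_commute)
  also have "?c * of_real \<dots> = kappa j / 2 * of_real ?rhs"
    by (rule kappa_cancel)
  also have "\<dots> = ?R $$ (j, k)"
  proof -
    have "?R = of_real u \<cdot>\<^sub>m (Psi l u * R2_mat l) + Psi l u * R1_mat l"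
      by (simp add: mult_add_distrib_mat[of _ "Suc l" "Suc l" _ "Suc l"] mult_smult_distrib[of _ "Suc l" "Suc l" _ "Suc l"])
    also have "\<dots> $$ (j, k) = kappa j / 2 * of_real ?rhs"
    proof -
      (* In the last column the neighbour on the right is missing, and its coefficient l - k is zero. *)
      have "k < l \<or> l = k" using jk by linarith
      then show ?thesis using jk
        by (elim disjE; cases k) (auto simp: index_mult_coeff Psi_index field_simps simp del: index_mult_mat(1))
    qed
    finally show ?thesis by simp
  qed
  finally show "?L $$ (j, k) = ?R $$ (j, k)" .
qed simp_all

lemma E_intertwining_order_0:
  "(\<i> / 2) \<cdot>\<^sub>m ((of_real (1 - u\<^sup>2) \<cdot>\<^sub>m Q0_mat l + Q1_mat l) * Psi' l u)
     - (\<i> / 2 * of_real u) \<cdot>\<^sub>m (M_mat l * Psi l u) - (1 / 2) \<cdot>\<^sub>m (V0_mat l * Psi l u)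
     = Psi l u * M0_mat l" (is "?A - ?M - ?V = ?R")
proof (rule eq_matI)
  fix j k assume "j < dim_row ?R" "k < dim_col ?R"
  then have jk: "j < Suc l" "k < Suc l" by simp_all
  let ?c = "kappa j / (2 * (2 * of_nat j + 1))"
  let ?x = "\<lambda>i. (real k + real i + 2) * phi (Suc i) k u"
  let ?a = "(1 - u\<^sup>2) * ((real j + 1) * (real l + real j + 2) * ?x (Suc j))
      - real j * (real l - real j + 1) * ?x (j - 1)"
  let ?m = "u * ((2 * real j + 3) * ((real j + 1) * (real l + real j + 2)) * phi (Suc j) k u)"
  let ?v = "(2 * real j + 1) * (real j * (real j + 1) * phi j k u)"
  have A: "?A $$ (j, k) = ?c * of_real ?a"
    using jk by (intro index_E_leading Psi_index(2)) (auto simp: phi_eq_0)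
  have M: "?M $$ (j, k) = ?c * of_real ?m"
  proof -
    have "?M $$ (j, k) = of_real u * (\<i> / 2 * (M_mat l * Psi l u) $$ (j, k))"
      using jk by (simp del: index_mult_mat(1))
    also have "\<i> / 2 * (M_mat l * Psi l u) $$ (j, k)
        = ?c * of_real ((2 * real j + 3) * ((real j + 1) * (real l + real j + 2)) * phi (Suc j) k u)"
      using jk by (intro index_M_mult Psi_index(1)) (auto simp: phi_eq_0)
    finally show ?thesis by (simp only: of_real_mult[of u] mult.left_commute)
  qed
  have V: "?V $$ (j, k) = ?c * of_real ?v"
  proof -
    have "?V $$ (j, k) = kappa j / 2 * of_real (real j * (real j + 1) * phi j k u)"
      using jk by (simp add: index_coeff_mult Psi_index del: index_mult_mat(1))
    then show ?thesis unfolding kappa_cancel .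
  qed
  have "(?A - ?M - ?V) $$ (j, k) = ?A $$ (j, k) - ?M $$ (j, k) - ?V $$ (j, k)"
    using jk by (simp del: index_mult_mat(1) index_smult_mat(1))
  also have "\<dots> = ?c * of_real (?a - ?m - ?v)"
    unfolding A M V by (simp only: of_real_diff right_diff_distrib)
  also have "?a - ?m - ?v = (2 * real j + 1) * (- (real k * (real l + 2)) * phi j k u)"
  proof -
    have "real j * (real l - real j + 1) * ?x (j - 1)
        = real j * (real l - real j + 1) * ((real k + real j + 1) * phi j k u)"
      by (cases j) (simp_all add: add_ac)
    then show ?thesis
      using phi_E_order_zero[of j l k u] by (simp add: algebra_simps)
  qed
  also have "?c * of_real \<dots> = kappa j / 2 * of_real (- (real k * (real l + 2)) * phi j k u)"
    by (rule kappa_cancel)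
  also have "\<dots> = ?R $$ (j, k)"
    using jk by (simp add: index_mult_coeff Psi_index field_simps del: index_mult_mat(1))
  finally show "(?A - ?M - ?V) $$ (j, k) = ?R $$ (j, k)" .
qed simp_all

section \<open>Invertibility\<close>

lemma Psi_det_nonzero: "det (Psi l u) \<noteq> 0"
proof -
  have "upper_triangular (Psi l u)"
    by (rule upper_triangularI) (auto simp: Psi_index phi_eq_0)
  then have "det (Psi l u) = prod_list (diag_mat (Psi l u))"
    by (rule det_upper_triangular) (rule Psi_carrier)
  then show ?thesis
    by (auto simp: diag_mat_def Psi_index kappa_nonzero phi_diag_nonzero)
qed

lemma mat_inverse_Psi:
  assumes "v \<in> carrier_vec (Suc l)"
  shows "the (mat_inverse (Psi l u)) *\<^sub>v (Psi l u *\<^sub>v v) = v"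
proof -
  note carrier = Psi_carrier(1)[of l u]
  have "Psi l u \<in> Units (ring_mat TYPE(complex) (Suc l) ())"
    using det_non_zero_imp_unit[OF carrier Psi_det_nonzero] .
  then obtain B where B: "mat_inverse (Psi l u) = Some B"
    using mat_inverse(1)[OF carrier, where b = "()"] by (cases "mat_inverse (Psi l u)") auto
  then have "B * Psi l u = 1\<^sub>m (Suc l)" "B \<in> carrier_mat (Suc l) (Suc l)"
    using mat_inverse(2)[OF carrier] by auto
  then have "B *\<^sub>v (Psi l u *\<^sub>v v) = v"
    using assoc_mult_mat_vec[OF _ carrier] one_mult_mat_vec assms by metis
  then show ?thesis by (simp add: B)
qed

section \<open>Derivatives of vector valued functions\<close>

text \<open>
  The relational form of \<open>vderiv\<close>. It also records the dimension, since \<open>vderiv\<close> takes the dimension of its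
  result from the value of the function at the point.
\<close>

definition has_vderiv ::
  "nat \<Rightarrow> (real \<Rightarrow> complex Matrix.vec) \<Rightarrow> complex Matrix.vec \<Rightarrow> real \<Rightarrow> bool" where
  "has_vderiv n F F' u \<longleftrightarrow> F u \<in> carrier_vec n \<and> F' \<in> carrier_vec n \<and>
     (\<forall>i<n. ((\<lambda>t. vec_index (F t) i) has_vector_derivative vec_index F' i) (at u))"

lemma vderiv_eqI: "has_vderiv n F F' u \<Longrightarrow> vderiv F u = F'"
  by (intro eq_vecI) (auto simp: has_vderiv_def vderiv_def vector_derivative_at)

lemma has_vector_derivative_cong_on:
  assumes "open S" "u \<in> S" "\<And>t. t \<in> S \<Longrightarrow> f t = g t"
  shows "(f has_vector_derivative d) (at u) \<longleftrightarrow> (g has_vector_derivative d) (at u)"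
  using has_vector_derivative_transform_within_open[of f d u S g]
    has_vector_derivative_transform_within_open[of g d u S f] assms by auto

lemma has_vderiv_cong:
  assumes "open S" "u \<in> S" "\<And>t. t \<in> S \<Longrightarrow> F t = G t"
  shows "has_vderiv n F F' u \<longleftrightarrow> has_vderiv n G F' u"
proof -
  have "((\<lambda>t. vec_index (F t) i) has_vector_derivative d) (at u) \<longleftrightarrow>
      ((\<lambda>t. vec_index (G t) i) has_vector_derivative d) (at u)" for i d
    by (rule has_vector_derivative_cong_on[OF assms(1,2)]) (simp add: assms(3))
  then show ?thesis using assms by (simp add: has_vderiv_def)
qed

lemma has_vderiv_add:
  assumes "\<And>t. t \<in> S \<Longrightarrow> F t \<in> carrier_vec n" "\<And>t. t \<in> S \<Longrightarrow> G t \<in> carrier_vec n" "open S" "u \<in> S"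
    and "has_vderiv n F F' u" "has_vderiv n G G' u"
  shows "has_vderiv n (\<lambda>t. F t + G t) (F' + G') u"
proof -
  have "((\<lambda>t. vec_index (F t + G t) i) has_vector_derivative vec_index (F' + G') i) (at u)" if i: "i < n" for i
  proof -
    have "((\<lambda>t. vec_index (F t) i + vec_index (G t) i) has_vector_derivative vec_index F' i + vec_index G' i) (at u)"
      using assms(5,6) i by (intro has_vector_derivative_add) (auto simp: has_vderiv_def)
    moreover have "vec_index (F' + G') i = vec_index F' i + vec_index G' i"
      using assms(6) i by (auto simp: has_vderiv_def)
    moreover have "vec_index (F t + G t) i = vec_index (F t) i + vec_index (G t) i" if "t \<in> S" for t
      using assms(2)[OF that] i by auto
    ultimately show ?thesis
      using has_vector_derivative_cong_on[OF assms(3,4), of "\<lambda>t. vec_index (F t + G t) i"] by simp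
  qed
  then show ?thesis using assms(5,6) by (auto simp: has_vderiv_def)
qed

lemma has_vderiv_mult_mat_vec:
  assumes "\<And>t. P t \<in> carrier_mat n n" "P' \<in> carrier_mat n n" "\<And>t. t \<in> S \<Longrightarrow> F t \<in> carrier_vec n"
    and S: "open S" "u \<in> S"
    and P: "\<And>i k. i < n \<Longrightarrow> k < n \<Longrightarrow> ((\<lambda>t. P t $$ (i, k)) has_vector_derivative P' $$ (i, k)) (at u)"
    and F: "has_vderiv n F F' u"
  shows "has_vderiv n (\<lambda>t. P t *\<^sub>v F t) (P' *\<^sub>v F u + P u *\<^sub>v F') u"
proof -
  have F': "F' \<in> carrier_vec n" "F u \<in> carrier_vec n" using F by (auto simp: has_vderiv_def)
  have "((\<lambda>t. vec_index (P t *\<^sub>v F t) i) has_vector_derivative vec_index (P' *\<^sub>v F u + P u *\<^sub>v F') i) (at u)"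
    if i: "i < n" for i
  proof -
    have mv: "vec_index (A *\<^sub>v v) i = (\<Sum>k\<in>{0..<n}. A $$ (i, k) * vec_index v k)"
      if "A \<in> carrier_mat n n" "v \<in> carrier_vec n" for A :: "complex mat" and v
      using that i by (auto simp: scalar_prod_def)
    have "((\<lambda>t. \<Sum>k\<in>{0..<n}. P t $$ (i, k) * vec_index (F t) k) has_vector_derivative
        (\<Sum>k\<in>{0..<n}. P u $$ (i, k) * vec_index F' k + P' $$ (i, k) * vec_index (F u) k)) (at u)"
      using F i by (intro has_vector_derivative_sum has_vector_derivative_mult P) (auto simp: has_vderiv_def)
    moreover have "vec_index (P' *\<^sub>v F u + P u *\<^sub>v F') i
        = (\<Sum>k\<in>{0..<n}. P u $$ (i, k) * vec_index F' k + P' $$ (i, k) * vec_index (F u) k)"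
    proof -
      have "vec_index (P' *\<^sub>v F u + P u *\<^sub>v F') i = vec_index (P' *\<^sub>v F u) i + vec_index (P u *\<^sub>v F') i"
        using assms(1)[of u] i by (intro index_add_vec) auto
      then show ?thesis
        unfolding mv[OF assms(2) F'(2)] mv[OF assms(1) F'(1)] by (simp add: sum.distrib)
    qed
    ultimately show ?thesis
      using has_vector_derivative_cong_on[OF S mv[OF assms(1) assms(3)]] by simp
  qed
  then show ?thesis
    using assms(1)[of u] assms(2) F' by (auto simp: has_vderiv_def intro!: add_carrier_vec mult_mat_vec_carrier)
qed

lemma smooth_vec_vderiv:
  assumes F: "smooth_vec_on n S F" and S: "open S" and u: "u \<in> S"
  shows "has_vderiv n F (vderiv F u) u" "has_vderiv n (vderiv F) (vderiv (vderiv F) u) u"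
proof -
  have car: "F t \<in> carrier_vec n" if "t \<in> S" for t
    using F that by (simp add: smooth_vec_on_def)
  have dim: "vderiv F t \<in> carrier_vec n" if "t \<in> S" for t
    using carrier_vecD[OF car[OF that]] unfolding vderiv_def by (metis vec_carrier)
  have diff: "(\<lambda>t. vec_index (F t) i) differentiable (at t)"
    "(\<lambda>t. vector_derivative (\<lambda>t. vec_index (F t) i) (at t)) differentiable (at t)"
    if "i < n" "t \<in> S" for i t
  proof -
    have *: "((\<lambda>g t. vector_derivative g (at t)) ^^ m) (\<lambda>t. vec_index (F t) i) differentiable (at t)" for m
      using F that by (simp add: smooth_vec_on_def smooth_fun_on_def)
    show "(\<lambda>t. vec_index (F t) i) differentiable (at t)" using *[of 0] by simp
    show "(\<lambda>t. vector_derivative (\<lambda>t. vec_index (F t) i) (at t)) differentiable (at t)" using *[of 1] by simp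
  qed
  have idx: "vec_index (vderiv F t) i = vector_derivative (\<lambda>t. vec_index (F t) i) (at t)"
    if "i < n" "t \<in> S" for i t
    using carrier_vecD[OF car[OF that(2)]] that(1) unfolding vderiv_def by (simp only: index_vec)
  show "has_vderiv n F (vderiv F u) u"
    unfolding has_vderiv_def
  proof (intro conjI allI impI car dim u)
    fix i assume i: "i < n"
    show "((\<lambda>t. vec_index (F t) i) has_vector_derivative vec_index (vderiv F u) i) (at u)"
      using diff(1)[OF i u] unfolding idx[OF i u] vector_derivative_works .
  qed
  have "((\<lambda>t. vec_index (vderiv F t) i) has_vector_derivative vec_index (vderiv (vderiv F) u) i) (at u)"
    if i: "i < n" for i
  proof -
    have "(\<lambda>t. vec_index (vderiv F t) i) differentiable (at u)"
      using diff(2)[OF i u] has_vector_derivative_cong_on[OF S u idx[OF i]]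
      unfolding vector_derivative_works by (intro vector_derivative_works[THEN iffD1] differentiableI_vector) (rule iffD2)
    then show ?thesis
      using carrier_vecD[OF dim[OF u]] i unfolding vderiv_def[of "vderiv F"]
      by (simp only: index_vec vector_derivative_works)
  qed
  moreover have "vderiv (vderiv F) u \<in> carrier_vec n"
    using carrier_vecD[OF dim[OF u]] vec_carrier unfolding vderiv_def[of "vderiv F"] by metis
  ultimately show "has_vderiv n (vderiv F) (vderiv (vderiv F) u) u"
    unfolding has_vderiv_def using dim[OF u] by blast
qed

section \<open>Conjugating the operators\<close>

lemma Psi_has_derivative:
  assumes "i < Suc l" "k < Suc l"
  shows "((\<lambda>t. Psi l t $$ (i, k)) has_vector_derivative Psi' l u $$ (i, k)) (at u)"
    "((\<lambda>t. Psi' l t $$ (i, k)) has_vector_derivative Psi'' l u $$ (i, k)) (at u)"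
proof -
  have d: "((\<lambda>t. c * complex_of_real (f t)) has_vector_derivative c * of_real f') (at u)"
    if "(f has_real_derivative f') (at u)" for f :: "real \<Rightarrow> real" and f' c
    using that
    by (intro has_vector_derivative_mult_right has_vector_derivative_of_real)
       (simp add: has_real_derivative_iff_has_vector_derivative)
  show "((\<lambda>t. Psi l t $$ (i, k)) has_vector_derivative Psi' l u $$ (i, k)) (at u)"
    unfolding Psi_index[OF assms] by (intro d phi_deriv)
  have "((\<lambda>t. (real k + real i + 2) * phi (Suc i) k t) has_real_derivative
      (real k + real i + 2) * ((real k + real i + 3) * phi (Suc (Suc i)) k u)) (at u)"
    using DERIV_cmult[OF phi_deriv[of "Suc i" k u], of "real k + real i + 2"] by (simp add: add_ac)
  then show "((\<lambda>t. Psi' l t $$ (i, k)) has_vector_derivative Psi'' l u $$ (i, k)) (at u)"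
    unfolding Psi_index[OF assms] by (intro d)
qed

lemma smult_mat_mult_vec:
  assumes "A \<in> carrier_mat n m" "v \<in> carrier_vec m"
  shows "(a \<cdot>\<^sub>m A) *\<^sub>v v = a \<cdot>\<^sub>v (A *\<^sub>v v :: 'a :: comm_semiring_0 Matrix.vec)"
  using assms by (intro eq_vecI) (auto simp: scalar_prod_def sum_distrib_left mult_ac)

text \<open>
  The next two lemmas are pure linear algebra: \<open>P0\<close>, \<open>P1\<close>, \<open>P2\<close> stand for \<open>\<Psi>\<close> and its derivatives at a point and
  \<open>f0\<close>, \<open>f1\<close>, \<open>f2\<close> for \<open>F\<close> and its derivatives there, the product rule being already carried out. The terms are
  sorted by the order of the derivative of \<open>F\<close>.
\<close>

lemma second_order_conjugation:
  fixes P0 P1 P2 :: "complex mat"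
  assumes car: "P0 \<in> carrier_mat n n" "P1 \<in> carrier_mat n n" "P2 \<in> carrier_mat n n"
      "C \<in> carrier_mat n n" "V \<in> carrier_mat n n" "B0 \<in> carrier_mat n n" "B1 \<in> carrier_mat n n"
      "f0 \<in> carrier_vec n" "f1 \<in> carrier_vec n" "f2 \<in> carrier_vec n"
    and e0: "a \<cdot>\<^sub>m P2 - b \<cdot>\<^sub>m (C * P1) - V * P0 = P0 * B0"
    and e1: "(2 * a) \<cdot>\<^sub>m P1 - b \<cdot>\<^sub>m (C * P0) = P0 * B1"
  shows "a \<cdot>\<^sub>v (P2 *\<^sub>v f0 + P1 *\<^sub>v f1 + (P1 *\<^sub>v f1 + P0 *\<^sub>v f2)) - b \<cdot>\<^sub>v (C *\<^sub>v (P1 *\<^sub>v f0 + P0 *\<^sub>v f1)) - V *\<^sub>v (P0 *\<^sub>v f0)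
    = P0 *\<^sub>v (a \<cdot>\<^sub>v f2 + B1 *\<^sub>v f1 + B0 *\<^sub>v f0)"
proof -
  note distribs = minus_mult_distrib_mat_vec[of _ n n] mult_add_distrib_mat_vec[of _ n n]
    smult_mat_mult_vec[of _ n n] assoc_mult_mat_vec[of _ n n _ n] mult_mat_vec[of _ n n]
    mult_carrier_mat[of _ n n _ n] minus_carrier_mat mult_mat_vec_carrier[of _ n n] assoc_add_vec[of _ n]
  have E0: "a \<cdot>\<^sub>v (P2 *\<^sub>v f0) - b \<cdot>\<^sub>v (C *\<^sub>v (P1 *\<^sub>v f0)) - V *\<^sub>v (P0 *\<^sub>v f0) = P0 *\<^sub>v (B0 *\<^sub>v f0)"
    using arg_cong[OF e0, of "\<lambda>M. M *\<^sub>v f0"] car by (simp add: distribs)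
  have E1: "(2 * a) \<cdot>\<^sub>v (P1 *\<^sub>v f1) - b \<cdot>\<^sub>v (C *\<^sub>v (P0 *\<^sub>v f1)) = P0 *\<^sub>v (B1 *\<^sub>v f1)"
    using arg_cong[OF e1, of "\<lambda>M. M *\<^sub>v f1"] car by (simp add: distribs)
  have "P0 *\<^sub>v (a \<cdot>\<^sub>v f2 + B1 *\<^sub>v f1 + B0 *\<^sub>v f0) = a \<cdot>\<^sub>v (P0 *\<^sub>v f2) + P0 *\<^sub>v (B1 *\<^sub>v f1) + P0 *\<^sub>v (B0 *\<^sub>v f0)"
    using car by (simp add: distribs)
  moreover have "C *\<^sub>v (P1 *\<^sub>v f0 + P0 *\<^sub>v f1) = C *\<^sub>v (P1 *\<^sub>v f0) + C *\<^sub>v (P0 *\<^sub>v f1)"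
    using car by (simp add: distribs)
  ultimately show ?thesis
    unfolding E0[symmetric] E1[symmetric] using car
    by (intro eq_vecI) (auto simp: algebra_simps simp del: index_mult_mat_vec)
qed

lemma first_order_conjugation:
  fixes P0 P1 :: "complex mat"
  assumes car: "P0 \<in> carrier_mat n n" "P1 \<in> carrier_mat n n"
      "A \<in> carrier_mat n n" "M \<in> carrier_mat n n" "V \<in> carrier_mat n n" "B0 \<in> carrier_mat n n" "B1 \<in> carrier_mat n n"
      "f0 \<in> carrier_vec n" "f1 \<in> carrier_vec n"
    and e0: "a \<cdot>\<^sub>m (A * P1) - b \<cdot>\<^sub>m (M * P0) - c \<cdot>\<^sub>m (V * P0) = P0 * B0"
    and e1: "a \<cdot>\<^sub>m (A * P0) = P0 * B1"
  shows "a \<cdot>\<^sub>v (A *\<^sub>v (P1 *\<^sub>v f0 + P0 *\<^sub>v f1)) - b \<cdot>\<^sub>v (M *\<^sub>v (P0 *\<^sub>v f0)) - c \<cdot>\<^sub>v (V *\<^sub>v (P0 *\<^sub>v f0))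
    = P0 *\<^sub>v (B1 *\<^sub>v f1 + B0 *\<^sub>v f0)"
proof -
  note distribs = minus_mult_distrib_mat_vec[of _ n n] mult_add_distrib_mat_vec[of _ n n]
    smult_mat_mult_vec[of _ n n] assoc_mult_mat_vec[of _ n n _ n] mult_mat_vec[of _ n n]
    mult_carrier_mat[of _ n n _ n] minus_carrier_mat mult_mat_vec_carrier[of _ n n] assoc_add_vec[of _ n]
  have E0: "a \<cdot>\<^sub>v (A *\<^sub>v (P1 *\<^sub>v f0)) - b \<cdot>\<^sub>v (M *\<^sub>v (P0 *\<^sub>v f0)) - c \<cdot>\<^sub>v (V *\<^sub>v (P0 *\<^sub>v f0)) = P0 *\<^sub>v (B0 *\<^sub>v f0)"
    using arg_cong[OF e0, of "\<lambda>M. M *\<^sub>v f0"] car by (simp add: distribs)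
  have E1: "a \<cdot>\<^sub>v (A *\<^sub>v (P0 *\<^sub>v f1)) = P0 *\<^sub>v (B1 *\<^sub>v f1)"
    using arg_cong[OF e1, of "\<lambda>M. M *\<^sub>v f1"] car by (simp add: distribs)
  have "P0 *\<^sub>v (B1 *\<^sub>v f1 + B0 *\<^sub>v f0) = P0 *\<^sub>v (B1 *\<^sub>v f1) + P0 *\<^sub>v (B0 *\<^sub>v f0)"
    using car by (simp add: distribs)
  moreover have "A *\<^sub>v (P1 *\<^sub>v f0 + P0 *\<^sub>v f1) = A *\<^sub>v (P1 *\<^sub>v f0) + A *\<^sub>v (P0 *\<^sub>v f1)"
    using car by (simp add: distribs)
  ultimately show ?thesis
    unfolding E0[symmetric] E1[symmetric] using car
    by (intro eq_vecI) (auto simp: algebra_simps simp del: index_mult_mat_vec)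
qed

theorem theorem9p4:
  fixes l :: nat and F :: "real \<Rightarrow> complex Matrix.vec"
  assumes "even l"
    and "smooth_vec_on (l + 1) {0<..<1} F"
  shows "\<forall>u\<in>{0<..<1}.
      D_tilde l F u =
        of_real (1 - u\<^sup>2) \<cdot>\<^sub>v vderiv (vderiv F) u
        + (- of_real u \<cdot>\<^sub>m C_mat l + S1_mat l) *\<^sub>v vderiv F u
        + Lambda0_mat l *\<^sub>v F u
    \<and> E_tilde l F u =
        (of_real u \<cdot>\<^sub>m R2_mat l + R1_mat l) *\<^sub>v vderiv F u
        + M0_mat l *\<^sub>v F u"
proof
  (* An open set is needed: the second derivative at u uses the first one near u,
     where F is known to have the right dimension. *)
  let ?S = "{0<..<1} :: real set"
  let ?n = "Suc l"
  have F: "smooth_vec_on ?n ?S F" and S: "open ?S" using assms(2) by simp_all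
  note dF = smooth_vec_vderiv(1)[OF F S] and ddF = smooth_vec_vderiv(2)[OF F S]
  have car: "F t \<in> carrier_vec ?n" "vderiv F t \<in> carrier_vec ?n" "vderiv (vderiv F) t \<in> carrier_vec ?n"
    if "t \<in> ?S" for t
    using dF[OF that] ddF[OF that] by (auto simp: has_vderiv_def)
  let ?P = "\<lambda>t. Psi l t *\<^sub>v F t"
  have dP: "has_vderiv ?n ?P (Psi' l t *\<^sub>v F t + Psi l t *\<^sub>v vderiv F t) t" if t: "t \<in> ?S" for t
    by (intro has_vderiv_mult_mat_vec[OF _ _ _ S t] Psi_carrier car(1) Psi_has_derivative dF t)
  have vP: "vderiv ?P t = Psi' l t *\<^sub>v F t + Psi l t *\<^sub>v vderiv F t" if "t \<in> ?S" for t
    using dP[OF that] by (rule vderiv_eqI)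
  fix u :: real assume u: "u \<in> ?S"
  have "has_vderiv ?n (\<lambda>t. Psi' l t *\<^sub>v F t + Psi l t *\<^sub>v vderiv F t)
     ((Psi'' l u *\<^sub>v F u + Psi' l u *\<^sub>v vderiv F u) + (Psi' l u *\<^sub>v vderiv F u + Psi l u *\<^sub>v vderiv (vderiv F) u)) u"
    by (intro has_vderiv_add[OF _ _ S u] has_vderiv_mult_mat_vec[OF _ _ _ S u] mult_mat_vec_carrier[of _ ?n ?n]
        Psi_carrier car Psi_has_derivative dF ddF u)
  then have "has_vderiv ?n (vderiv ?P)
     ((Psi'' l u *\<^sub>v F u + Psi' l u *\<^sub>v vderiv F u) + (Psi' l u *\<^sub>v vderiv F u + Psi l u *\<^sub>v vderiv (vderiv F) u)) u"
    using has_vderiv_cong[OF S u, of "vderiv ?P", OF vP] by blast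
  note vvP = vderiv_eqI[OF this]
  have "D_bar l ?P u = Psi l u *\<^sub>v (of_real (1 - u\<^sup>2) \<cdot>\<^sub>v vderiv (vderiv F) u
      + (- of_real u \<cdot>\<^sub>m C_mat l + S1_mat l) *\<^sub>v vderiv F u + Lambda0_mat l *\<^sub>v F u)"
    unfolding D_bar_def vvP vP[OF u]
    by (rule second_order_conjugation[of _ ?n])
       (use D_intertwining_order_0[of u l] D_intertwining_order_1[of u l] in \<open>simp_all add: car[OF u]\<close>)
  moreover have "E_bar l ?P u = Psi l u *\<^sub>v ((of_real u \<cdot>\<^sub>m R2_mat l + R1_mat l) *\<^sub>v vderiv F u + M0_mat l *\<^sub>v F u)"
    unfolding E_bar_def vP[OF u]
    by (rule first_order_conjugation[of _ ?n])
       (use E_intertwining_order_0[of u l] E_intertwining_order_1[of u l] in \<open>simp_all add: car[OF u]\<close>)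
  moreover have "of_real (1 - u\<^sup>2) \<cdot>\<^sub>v vderiv (vderiv F) u
      + (- of_real u \<cdot>\<^sub>m C_mat l + S1_mat l) *\<^sub>v vderiv F u + Lambda0_mat l *\<^sub>v F u \<in> carrier_vec ?n"
    "(of_real u \<cdot>\<^sub>m R2_mat l + R1_mat l) *\<^sub>v vderiv F u + M0_mat l *\<^sub>v F u \<in> carrier_vec ?n"
    using car[OF u] by (simp_all add: mult_mat_vec_carrier[of _ ?n ?n])
  ultimately show "D_tilde l F u =
        of_real (1 - u\<^sup>2) \<cdot>\<^sub>v vderiv (vderiv F) u
        + (- of_real u \<cdot>\<^sub>m C_mat l + S1_mat l) *\<^sub>v vderiv F u
        + Lambda0_mat l *\<^sub>v F u
    \<and> E_tilde l F u =
        (of_real u \<cdot>\<^sub>m R2_mat l + R1_mat l) *\<^sub>v vderiv F u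
        + M0_mat l *\<^sub>v F u"
    unfolding D_tilde_def E_tilde_def conj_Psi_def
    by (simp only: mat_inverse_Psi simp_thms)
qed

end
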